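(* Let $U^{\rm c}_\pm\colon\mathsf{GQ}^{\rm ji}\to\mathsf{IF}^{\rm c}_\pm$ send a join-idempotent Girard quantale $\mathcal{Q}$ to the restriction of the frame $U_\pm(\mathcal{Q})$ to those of its elements which are idempotent and satisfy containment, and send a morphism $f$ to the restriction of $U_\pm f$. Let $F^{\rm c}_\pm\colon\mathsf{IF}^{\rm c}_\pm\to\mathsf{GQ}^{\rm ji}$ be the corestriction of $F_\pm\circ\iota^{\rm c}$ to join-idempotent Girard quantales. Then $U^{\rm c}_\pm$ and $F^{\rm c}_\pm$ are well-defined as functors, and $F^{\rm c}_\pm\dashv U^{\rm c}_\pm$.
   Context: All monoids and quantales are commutative and unital. $\mathbb{N}[X]$ is the set of finite multisets of elements of $X$, a commutative monoid under multiset union, and $\mathbb{N}[X+X]\cong\mathbb{N}[X]\times\mathbb{N}[X]$. **Girard quantales.** A Girard quantale is a quantale $\mathcal{Q}=(Q,\otimes,I,\le)$ with a dualizing element $\bot_{\mathcal{Q}}$ (not necessarily the bottom): writing $a^\bot:=\bigvee\{c\mid c\otimes a\le\bot_{\mathcal{Q}}\}$, one has $a^{\bot\bot}=a$ for all $a$. $\mathsf{GQ}$ is the category of Girard quantales whose morphisms are quantale homomorphisms $f$ (preserving arbitrary joins, $\otimes$ and unit) with $f(\bot)\le\bot$. $\mathsf{GQ}^{\rm ji}$ is the full subcategory of join-idempotent Girard quantales: those in which every element is a join of $\otimes$-idempotent elements. **Implication frames.** An implication frame is a set $X$ with a subset $\bot\subseteq\mathbb{N}[X+X]$; elements of $\mathbb{N}[X+X]$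 are positions. For a position $p$, $p^\bot:=\{p'\mid p+p'\in\bot\}$, and for a set $A$ of positions, $A^\bot:=\bigcap_{p\in A}p^\bot$. $\mathsf{IF}_\pm$ is the category of implication frames; a morphism $(X,\bot_X)\to(Y,\bot_Y)$ is a function $f\colon X\to Y$ such that, with $f\times f$ the induced map on positions, $(f\times f)(\bot_X)\subseteq\bot_Y$ and, for all $A,B\subseteq\mathbb{N}[X+X]$, $A^\bot\subseteq B^\bot$ implies $(f\times f)(A)^\bot\subseteq(f\times f)(B)^\bot$. An element $x$ is reflexive if $(\{x\},\{x\})\in\bot$; $\mathsf{IF}^{\rm r}_\pm\subseteq\mathsf{IF}_\pm$ is the full subcategory of frames all of whose elements are reflexive. An element $x$ of a frame is idempotent if $(\{x\},\varnothing)^\bot=(\{x,x\},\varnothing)^\bot$ and $(\varnothing,\{x\})^\bot=(\varnothing,\{x,x\})^\bot$; it satisfies containment if $(\{x\},\{x\})^\bot$ is the set of all positions. A containment implication frame is one in which every element is idempotent and satisfies containment; $\iota^{\rm c}\colon\mathsf{IF}^{\rm c}_\pm\rightarrowtail\mathsf{IF}^{\rm r}_\pm$ is the full subcategory of these. The restriction of a frame $(X,\bot)$ to $X'\subseteq X$ is $(X',\bot\cap\mathbb{N}[X'+X'])$. **The functors.** $F_\pm\colon\mathsf{IF}^{\rm r}_\pm\to\mathsf{GQ}$ sends $(X,\bot)$ to the Girard quantale of subsets $A\subseteq\mathbb{N}[X+X]$ with $A^{\bot\bot}=A$, ordered by inclusion, with $A\otimes B=\{a+b\mid a\in A,b\in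 B\}^{\bot\bot}$, joins $(\bigcup_iA_i)^{\bot\bot}$, and dualizing element $\bot$; it sends a morphism $f$ to $A\mapsto(f\times f)(A)^{\bot\bot}$. $U_\pm\colon\mathsf{GQ}\to\mathsf{IF}^{\rm r}_\pm$ sends $\mathcal{Q}$ to the frame with underlying set $\{\langle a_+,a_-\rangle\in Q^2\mid a_+\otimes a_-\le\bot_{\mathcal{Q}}\}$, in which a position $(\Gamma,\Delta)$ is in $\bot$ iff $\bigotimes_{\langle a_+,a_-\rangle\in\Gamma}a_+\otimes\bigotimes_{\langle b_+,b_-\rangle\in\Delta}b_-\le\bot_{\mathcal{Q}}$ (with multiplicity); it sends $f$ to the restriction of $f\times f$. *)

theory Defs
  imports
    "HOL-Library.Multiset"
    "HOL-Library.Product_Plus"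
    "HOL-Algebra.Complete_Lattice"
    "HOL-Algebra.FiniteProduct"
begin

section \<open>Girard quantales\<close>

text \<open>Joins are not a component of the record: they are the suprema of the order \<open>qle\<close>,
  taken in the HOL-Algebra lattice \<open>qord Q\<close>. The component \<open>qbot\<close> is the
  dualizing element, which need not be the least element.\<close>

record 'a quantale = "'a monoid" +
  qle :: "'a \<Rightarrow> 'a \<Rightarrow> bool"
  qbot :: 'a

definition qord :: "'a quantale \<Rightarrow> 'a gorder" where
  "qord Q = \<lparr>carrier = carrier Q, eq = (=), le = qle Q\<rparr>"

definition qjoin :: "'a quantale \<Rightarrow> 'a set \<Rightarrow> 'a" where
  "qjoin Q A = \<Squnion>\<^bsub>qord Q\<^esub> A"

definition quantale :: "'a quantale \<Rightarrow> bool" where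
  "quantale Q \<longleftrightarrow> comm_monoid Q \<and> complete_lattice (qord Q) \<and>
     (\<forall>a\<in>carrier Q. \<forall>A. A \<subseteq> carrier Q \<longrightarrow>
        a \<otimes>\<^bsub>Q\<^esub> qjoin Q A = qjoin Q ((\<lambda>b. a \<otimes>\<^bsub>Q\<^esub> b) ` A))"

definition qdual :: "'a quantale \<Rightarrow> 'a \<Rightarrow> 'a" where
  "qdual Q a = qjoin Q {c \<in> carrier Q. qle Q (c \<otimes>\<^bsub>Q\<^esub> a) (qbot Q)}"

definition GQ :: "'a quantale set" where
  "GQ = {Q. quantale Q \<and> qbot Q \<in> carrier Q \<and>
            (\<forall>a\<in>carrier Q. qdual Q (qdual Q a) = a)}"

definition GQji :: "'a quantale set" where
  "GQji = {Q \<in> GQ. \<forall>a\<in>carrier Q.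
             \<exists>E \<subseteq> {e \<in> carrier Q. e \<otimes>\<^bsub>Q\<^esub> e = e}. a = qjoin Q E}"

text \<open>Morphisms are extensional functions (value \<open>undefined\<close> off the carrier), so that
  equality of morphisms is equality in HOL; identities and composites are \<open>\<lambda>a\<in>carrier Q. a\<close>
  and \<^const>\<open>compose\<close>. Source and target may live over different types, because the functors
  below change the type of the elements.\<close>

definition gq_hom :: "'a quantale \<Rightarrow> 'b quantale \<Rightarrow> ('a \<Rightarrow> 'b) set" where
  "gq_hom P Q = {f \<in> carrier P \<rightarrow>\<^sub>E carrier Q.
     (\<forall>A. A \<subseteq> carrier P \<longrightarrow> f (qjoin P A) = qjoin Q (f ` A)) \<and>
     (\<forall>a\<in>carrier P. \<forall>b\<in>carrier P. f (a \<otimes>\<^bsub>P\<^esub> b) = f a \<otimes>\<^bsub>Q\<^esub> f b) \<and>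
     f \<one>\<^bsub>P\<^esub> = \<one>\<^bsub>Q\<^esub> \<and>
     qle Q (f (qbot P)) (qbot Q)}"


section \<open>Implication frames\<close>

text \<open>Positions are represented in \<open>\<nat>[X] \<times> \<nat>[X]\<close> rather than \<open>\<nat>[X + X]\<close>; their sum is the
  componentwise multiset union.\<close>

type_synonym 'x position = "'x multiset \<times> 'x multiset"

record 'x frame =
  elts :: "'x set"
  fbot :: "'x position set"

definition positions :: "'x set \<Rightarrow> 'x position set" where
  "positions S = {p. set_mset (fst p) \<subseteq> S \<and> set_mset (snd p) \<subseteq> S}"

definition frame :: "'x frame \<Rightarrow> bool" where
  "frame X \<longleftrightarrow> fbot X \<subseteq> positions (elts X)"

text \<open>In particular \<open>perp X {}\<close> is the set of all positions. For a single position \<open>p\<close>,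
  \<open>p\<^sup>\<bottom>\<close> is \<open>perp X {p}\<close>.\<close>

definition perp :: "'x frame \<Rightarrow> 'x position set \<Rightarrow> 'x position set" where
  "perp X A = {q \<in> positions (elts X). \<forall>p\<in>A. p + q \<in> fbot X}"

definition map_pos :: "('x \<Rightarrow> 'y) \<Rightarrow> 'x position \<Rightarrow> 'y position" where
  "map_pos f = map_prod (image_mset f) (image_mset f)"

definition if_hom :: "'x frame \<Rightarrow> 'y frame \<Rightarrow> ('x \<Rightarrow> 'y) set" where
  "if_hom X Y = {f \<in> elts X \<rightarrow>\<^sub>E elts Y.
     map_pos f ` fbot X \<subseteq> fbot Y \<and>
     (\<forall>A B. A \<subseteq> positions (elts X) \<longrightarrow> B \<subseteq> positions (elts X) \<longrightarrow>
        perp X A \<subseteq> perp X B \<longrightarrow> perp Y (map_pos f ` A) \<subseteq> perp Y (map_pos f ` B))}"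

definition reflexive_elt :: "'x frame \<Rightarrow> 'x \<Rightarrow> bool" where
  "reflexive_elt X x \<longleftrightarrow> ({#x#}, {#x#}) \<in> fbot X"

definition idempotent_elt :: "'x frame \<Rightarrow> 'x \<Rightarrow> bool" where
  "idempotent_elt X x \<longleftrightarrow>
     perp X {({#x#}, {#})} = perp X {({#x, x#}, {#})} \<and>
     perp X {({#}, {#x#})} = perp X {({#}, {#x, x#})}"

definition containment_elt :: "'x frame \<Rightarrow> 'x \<Rightarrow> bool" where
  "containment_elt X x \<longleftrightarrow> perp X {({#x#}, {#x#})} = positions (elts X)"

definition IFr :: "'x frame set" where
  "IFr = {X. frame X \<and> (\<forall>x\<in>elts X. reflexive_elt X x)}"

definition IFc :: "'x frame set" where
  "IFc = {X. frame X \<and> (\<forall>x\<in>elts X. idempotent_elt X x \<and> containment_elt X x)}"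

lemma IFc_subset_IFr: "IFc \<subseteq> IFr"
proof
  fix X :: "'x frame"
  assume X: "X \<in> IFc"
  have "reflexive_elt X x" if "x \<in> elts X" for x
  proof -
    have "0 \<in> positions (elts X)"
      by (simp add: positions_def)
    then have "0 \<in> perp X {({#x#}, {#x#})}"
      using X that by (simp add: IFc_def containment_elt_def)
    then show ?thesis
      by (simp add: perp_def reflexive_elt_def)
  qed
  with X show "X \<in> IFr"
    by (simp add: IFc_def IFr_def)
qed

definition restrict_frame :: "'x frame \<Rightarrow> 'x set \<Rightarrow> 'x frame" where
  "restrict_frame X S = \<lparr>elts = S, fbot = fbot X \<inter> positions S\<rparr>"


section \<open>The functors\<close>

definition F_obj :: "'x frame \<Rightarrow> 'x position set quantale" where
  "F_obj X =
     \<lparr>carrier = {A. A \<subseteq> positions (elts X) \<and> perp X (perp X A) = A},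
      mult = (\<lambda>A B. perp X (perp X {a + b | a b. a \<in> A \<and> b \<in> B})),
      one = perp X (perp X {0}),
      qle = (\<subseteq>),
      qbot = fbot X\<rparr>"

definition F_map :: "'x frame \<Rightarrow> 'y frame \<Rightarrow> ('x \<Rightarrow> 'y) \<Rightarrow> 'x position set \<Rightarrow> 'y position set" where
  "F_map X Y f = (\<lambda>A\<in>carrier (F_obj X). perp Y (perp Y (map_pos f ` A)))"

definition mset_tensor :: "'a quantale \<Rightarrow> ('b \<Rightarrow> 'a) \<Rightarrow> 'b multiset \<Rightarrow> 'a" where
  "mset_tensor Q h M = (\<Otimes>\<^bsub>Q\<^esub>x\<in>set_mset M. h x [^]\<^bsub>Q\<^esub> count M x)"

definition U_elts :: "'a quantale \<Rightarrow> ('a \<times> 'a) set" where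
  "U_elts Q = {(a, b). a \<in> carrier Q \<and> b \<in> carrier Q \<and> qle Q (a \<otimes>\<^bsub>Q\<^esub> b) (qbot Q)}"

definition U_obj :: "'a quantale \<Rightarrow> ('a \<times> 'a) frame" where
  "U_obj Q =
     \<lparr>elts = U_elts Q,
      fbot = {p \<in> positions (U_elts Q).
        qle Q (mset_tensor Q fst (fst p) \<otimes>\<^bsub>Q\<^esub> mset_tensor Q snd (snd p)) (qbot Q)}\<rparr>"

definition U_map :: "'a quantale \<Rightarrow> 'b quantale \<Rightarrow> ('a \<Rightarrow> 'b) \<Rightarrow> 'a \<times> 'a \<Rightarrow> 'b \<times> 'b" where
  "U_map P Q f = restrict (map_prod f f) (elts (U_obj P))"

definition Uc_obj :: "'a quantale \<Rightarrow> ('a \<times> 'a) frame" where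
  "Uc_obj Q = restrict_frame (U_obj Q)
     {x \<in> elts (U_obj Q). idempotent_elt (U_obj Q) x \<and> containment_elt (U_obj Q) x}"

definition Uc_map :: "'a quantale \<Rightarrow> 'b quantale \<Rightarrow> ('a \<Rightarrow> 'b) \<Rightarrow> 'a \<times> 'a \<Rightarrow> 'b \<times> 'b" where
  "Uc_map P Q f = restrict (U_map P Q f) (elts (Uc_obj P))"

text \<open>Precomposing with the inclusion of a full subcategory, and corestricting to one, changes
  neither the values on objects nor those on morphisms.\<close>

abbreviation Fc_obj :: "'x frame \<Rightarrow> 'x position set quantale" where
  "Fc_obj \<equiv> F_obj"

abbreviation Fc_map ::
  "'x frame \<Rightarrow> 'y frame \<Rightarrow> ('x \<Rightarrow> 'y) \<Rightarrow> 'x position set \<Rightarrow> 'y position set" where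
  "Fc_map \<equiv> F_map"

text \<open>An adjunction is a bijection between hom-sets, natural in both arguments. Since the
  functors change types, the bijections range over all types of frame elements and quantale
  elements, and HOL cannot quantify existentially over such a family; it is therefore named here,
  as the transposition \<open>g \<mapsto> U g \<circ> \<eta>\<close> along the unit \<open>\<eta>\<close>.\<close>

definition adj_unit :: "'x frame \<Rightarrow> 'x \<Rightarrow> 'x position set \<times> 'x position set" where
  "adj_unit X = (\<lambda>x\<in>elts X.
     (perp X (perp X {({#x#}, {#})}), perp X (perp X {({#}, {#x#})})))"

definition adj_transpose ::
  "'x frame \<Rightarrow> 'a quantale \<Rightarrow> ('x position set \<Rightarrow> 'a) \<Rightarrow> 'x \<Rightarrow> 'a \<times> 'a" where
  "adj_transpose X Q g = compose (elts X) (Uc_map (Fc_obj X) Q g) (adj_unit X)"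

end

theory Submission
  imports Defs
begin

text \<open>
  In a Girard quantale \<open>a \<le> b\<close> means that \<open>b \<otimes> c \<le> \<bottom>\<close> implies \<open>a \<otimes> c \<le> \<bottom>\<close> for all \<open>c\<close>; in a
  join-idempotent one it suffices to test idempotent \<open>c\<close>. Testing with the pairs \<open>\<langle>c, c\<^sup>\<bottom>\<rangle>\<close> shows that
  the elements of \<open>U\<^sup>c Q\<close> are the pairs of idempotents with \<open>a \<otimes> b = 0\<close>, the least element. Give a
  position of \<open>U\<^sup>c Q\<close> its tensor product as value. Since \<open>\<langle>e, 0\<rangle>\<close> is an element for each idempotent
  \<open>e\<close>, in \<open>U\<^sup>c Q\<close> the inclusion \<open>A\<^sup>\<bottom> \<subseteq> B\<^sup>\<bottom>\<close> means that the join of the values of \<open>B\<close> lies below that of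
  \<open>A\<close>. Hence quantale morphisms induce frame morphisms, and a frame morphism \<open>h : X \<rightarrow> U\<^sup>c Q\<close> is the
  transpose of \<open>A \<mapsto> \<Squnion>{value (h p) | p \<in> A}\<close>, the only candidate because \<open>F X\<close> is generated under joins
  and tensor by the components of the unit.
\<close>

section \<open>Quantales\<close>

locale comm_quantale = comm_monoid Q for Q :: "'a quantale" (structure) +
  assumes complete: "complete_lattice (qord Q)"
    and distrib: "\<lbrakk>a \<in> carrier Q; A \<subseteq> carrier Q\<rbrakk> \<Longrightarrow>
      a \<otimes> qjoin Q A = qjoin Q ((\<lambda>b. a \<otimes> b) ` A)"
begin

sublocale ord: complete_lattice "qord Q"
  by (rule complete)

abbreviation qle_syntax (infix \<open>\<preceq>\<close> 50) where "a \<preceq> b \<equiv> qle Q a b"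

lemma qord_simps [simp]: "carrier (qord Q) = carrier Q" "a \<sqsubseteq>\<^bsub>qord Q\<^esub> b \<longleftrightarrow> a \<preceq> b"
  by (simp_all add: qord_def)

lemma qle_refl [simp, intro]: "a \<in> carrier Q \<Longrightarrow> a \<preceq> a"
  using ord.le_refl by simp

lemma qle_trans: "\<lbrakk>a \<preceq> b; b \<preceq> c; a \<in> carrier Q; b \<in> carrier Q; c \<in> carrier Q\<rbrakk> \<Longrightarrow> a \<preceq> c"
  using ord.le_trans by simp

lemma qle_antisym: "\<lbrakk>a \<preceq> b; b \<preceq> a; a \<in> carrier Q; b \<in> carrier Q\<rbrakk> \<Longrightarrow> a = b"
  using ord.le_antisym by simp

lemma qjoin_closed [simp, intro]: "A \<subseteq> carrier Q \<Longrightarrow> qjoin Q A \<in> carrier Q"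
  using ord.weak.sup_closed by (simp add: qjoin_def)

lemma qjoin_upper: "\<lbrakk>A \<subseteq> carrier Q; a \<in> A\<rbrakk> \<Longrightarrow> a \<preceq> qjoin Q A"
  using ord.weak.sup_upper by (simp add: qjoin_def)

lemma qjoin_least: "\<lbrakk>A \<subseteq> carrier Q; c \<in> carrier Q; \<And>a. a \<in> A \<Longrightarrow> a \<preceq> c\<rbrakk> \<Longrightarrow> qjoin Q A \<preceq> c"
  using ord.weak.sup_least[of A c] by (simp add: qjoin_def)

lemma qjoin_le_iff:
  assumes "A \<subseteq> carrier Q" "c \<in> carrier Q"
  shows "qjoin Q A \<preceq> c \<longleftrightarrow> (\<forall>a\<in>A. a \<preceq> c)"
proof
  assume "qjoin Q A \<preceq> c"
  then show "\<forall>a\<in>A. a \<preceq> c"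
    using assms qjoin_upper[of A] qle_trans[of _ "qjoin Q A" c] by blast
qed (use assms qjoin_least in blast)

lemma qjoin_eqI:
  assumes "A \<subseteq> carrier Q" "s \<in> carrier Q"
    and "\<And>c. c \<in> carrier Q \<Longrightarrow> s \<preceq> c \<longleftrightarrow> (\<forall>a\<in>A. a \<preceq> c)"
  shows "qjoin Q A = s"
  using assms by (intro qle_antisym) (auto simp: qjoin_le_iff qjoin_upper)

lemma qjoin_singleton [simp]: "a \<in> carrier Q \<Longrightarrow> qjoin Q {a} = a"
  by (rule qjoin_eqI) auto

lemma qjoin_UN:
  assumes "\<And>i. i \<in> I \<Longrightarrow> A i \<subseteq> carrier Q"
  shows "qjoin Q (\<Union>i\<in>I. A i) = qjoin Q ((\<lambda>i. qjoin Q (A i)) ` I)"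
proof -
  have "(\<lambda>i. qjoin Q (A i)) ` I \<subseteq> carrier Q" "(\<Union>i\<in>I. A i) \<subseteq> carrier Q"
    using assms by auto
  then show ?thesis
    by (intro qjoin_eqI) (use assms in \<open>auto simp: qjoin_le_iff\<close>)
qed

text \<open>Distributivity is assumed for joins in the right factor; commutativity carries it over
  to the left one, and \<open>qjoin_UN\<close> flattens the resulting join of joins.\<close>

lemma qjoin_mult:
  assumes A: "A \<subseteq> carrier Q" and B: "B \<subseteq> carrier Q"
  shows "qjoin Q A \<otimes> qjoin Q B = qjoin Q {a \<otimes> b | a b. a \<in> A \<and> b \<in> B}"
proof -
  have "qjoin Q A \<otimes> qjoin Q B = qjoin Q B \<otimes> qjoin Q A"
    using A B by (simp add: m_comm)
  also have "\<dots> = qjoin Q ((\<lambda>a. qjoin Q B \<otimes> a) ` A)"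
    using A B by (simp add: distrib)
  also have "(\<lambda>a. qjoin Q B \<otimes> a) ` A = (\<lambda>a. qjoin Q ((\<lambda>b. a \<otimes> b) ` B)) ` A"
    using A B by (intro image_cong) (auto simp: m_comm distrib[symmetric] subset_iff)
  also have "qjoin Q \<dots> = qjoin Q (\<Union>a\<in>A. (\<lambda>b. a \<otimes> b) ` B)"
    using A B by (intro qjoin_UN[symmetric]) auto
  also have "(\<Union>a\<in>A. (\<lambda>b. a \<otimes> b) ` B) = {a \<otimes> b | a b. a \<in> A \<and> b \<in> B}"
    by auto
  finally show ?thesis .
qed

text \<open>The relation \<open>b \<preceq> c\<close> is the equation
  \<open>qjoin Q {b, c} = c\<close>, and tensoring with a preserves this join.\<close>

lemma mult_mono:
  assumes "b \<preceq> c" "a \<in> carrier Q" "b \<in> carrier Q" "c \<in> carrier Q"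
  shows "a \<otimes> b \<preceq> a \<otimes> c"
proof -
  have "qjoin Q {b, c} = c"
    using assms by (intro qjoin_eqI) (auto intro: qle_trans)
  then have "a \<otimes> c = qjoin Q {a \<otimes> b, a \<otimes> c}"
    using assms distrib[of a "{b, c}"] by simp
  then show ?thesis
    using assms qjoin_upper[of "{a \<otimes> b, a \<otimes> c}" "a \<otimes> b"] by simp
qed

text \<open>The empty join serves as the zero of the quantale; it is in general different from the
  dualizing element \<open>qbot Q\<close>.\<close>

lemma zero_least: "a \<in> carrier Q \<Longrightarrow> qjoin Q {} \<preceq> a"
  by (simp add: qjoin_le_iff)

lemma mult_zero: "a \<in> carrier Q \<Longrightarrow> qjoin Q {} \<otimes> a = qjoin Q {}"
  using distrib[of a "{}"] m_comm[of a "qjoin Q {}"] by simp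

end

lemma quantale_iff: "quantale Q \<longleftrightarrow> comm_quantale Q"
  by (auto simp: quantale_def comm_quantale_def comm_quantale_axioms_def)


section \<open>Girard quantales\<close>

locale girard_quantale = comm_quantale +
  assumes bot_closed [simp, intro]: "qbot Q \<in> carrier Q"
    and dual_dual: "a \<in> carrier Q \<Longrightarrow> qdual Q (qdual Q a) = a"
begin

lemma dual_closed [simp, intro]: "qdual Q a \<in> carrier Q"
  unfolding qdual_def by (rule qjoin_closed) auto

text \<open>Tensoring distributes over the join that defines the dual, so this join is itself one of
  the c with \<open>c \<otimes> a \<preceq> qbot Q\<close>; by \<open>le_dual\<close> it is the
  largest.\<close>

lemma mult_dual_le:
  assumes a: "a \<in> carrier Q"
  shows "a \<otimes> qdual Q a \<preceq> qbot Q"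
proof -
  have "a \<otimes> qdual Q a = qjoin Q ((\<lambda>c. a \<otimes> c) ` {c \<in> carrier Q. c \<otimes> a \<preceq> qbot Q})"
    unfolding qdual_def using a by (intro distrib) auto
  also have "\<dots> \<preceq> qbot Q"
    using a by (intro qjoin_least) (auto simp: m_comm)
  finally show ?thesis .
qed

lemma le_dual: "\<lbrakk>c \<in> carrier Q; c \<otimes> a \<preceq> qbot Q\<rbrakk> \<Longrightarrow> c \<preceq> qdual Q a"
  unfolding qdual_def by (rule qjoin_upper) auto

text \<open>Double duality makes the order the polarity induced by \<open>\<lambda>c a. c \<otimes> a \<preceq> \<bottom>\<close>.\<close>

lemma leI_bot:
  assumes "a \<in> carrier Q" "b \<in> carrier Q"
    and "\<And>c. \<lbrakk>c \<in> carrier Q; b \<otimes> c \<preceq> qbot Q\<rbrakk> \<Longrightarrow> a \<otimes> c \<preceq> qbot Q"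
  shows "a \<preceq> b"
proof -
  \<comment> \<open>The test element is the dual of b, admissible by \<open>mult_dual_le\<close>; it
    places a below the double dual of b.\<close>
  have "a \<otimes> qdual Q b \<preceq> qbot Q"
    using assms mult_dual_le by blast
  then show ?thesis
    using assms le_dual[of a "qdual Q b"] by (simp add: dual_dual)
qed

lemma eqI_bot:
  assumes "a \<in> carrier Q" "b \<in> carrier Q"
    and "\<And>c. c \<in> carrier Q \<Longrightarrow> a \<otimes> c \<preceq> qbot Q \<longleftrightarrow> b \<otimes> c \<preceq> qbot Q"
  shows "a = b"
proof (rule qle_antisym)
  show "a \<preceq> b" using assms by (auto intro: leI_bot)
  show "b \<preceq> a" using assms by (auto intro: leI_bot)
qed (use assms in auto)

end

lemma GQ_iff: "Q \<in> GQ \<longleftrightarrow> girard_quantale Q"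
  by (auto simp: GQ_def quantale_iff girard_quantale_def girard_quantale_axioms_def)

locale join_idempotent_quantale = girard_quantale +
  assumes join_idem: "a \<in> carrier Q \<Longrightarrow>
    \<exists>E \<subseteq> {e \<in> carrier Q. e \<otimes> e = e}. a = qjoin Q E"
begin

text \<open>An arbitrary test element c is a join of idempotents over which the tensor distributes,
  so c passes the test iff all these idempotents do. Only idempotents are available as components of
  elements of \<open>Uc_obj Q\<close>.\<close>

lemma leI_bot_idem:
  assumes a: "a \<in> carrier Q" and b: "b \<in> carrier Q"
    and le: "\<And>e. \<lbrakk>e \<in> carrier Q; e \<otimes> e = e; b \<otimes> e \<preceq> qbot Q\<rbrakk> \<Longrightarrow> a \<otimes> e \<preceq> qbot Q"
  shows "a \<preceq> b"
proof (rule leI_bot[OF a b])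
  fix c assume c: "c \<in> carrier Q" and bc: "b \<otimes> c \<preceq> qbot Q"
  obtain E where E: "E \<subseteq> {e \<in> carrier Q. e \<otimes> e = e}" "c = qjoin Q E"
    using join_idem[OF c] by auto
  have sub: "(\<lambda>e. x \<otimes> e) ` E \<subseteq> carrier Q" if "x \<in> carrier Q" for x
    using E(1) that by auto
  have eq: "x \<otimes> c = qjoin Q ((\<lambda>e. x \<otimes> e) ` E)" if "x \<in> carrier Q" for x
    using E that by (auto intro: distrib)
  show "a \<otimes> c \<preceq> qbot Q"
    using bc le E(1) a b by (auto simp: eq qjoin_le_iff sub)
qed

end

lemma GQji_iff: "Q \<in> GQji \<longleftrightarrow> join_idempotent_quantale Q"
  unfolding GQji_def mem_Collect_eq GQ_iff join_idempotent_quantale_def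
    join_idempotent_quantale_axioms_def by blast


section \<open>Values of positions\<close>

text \<open>The quantity that \<open>U_obj\<close> compares with \<open>qbot\<close>, named
  separately because it is a monoid homomorphism from positions to the quantale.\<close>

definition pos_value :: "'a quantale \<Rightarrow> ('a \<times> 'a) position \<Rightarrow> 'a" where
  "pos_value Q p = mset_tensor Q fst (fst p) \<otimes>\<^bsub>Q\<^esub> mset_tensor Q snd (snd p)"

context comm_monoid
begin

text \<open>The additional factors have exponent 0. Tensors over different multisets can thus be
  written over one index set and multiplied factor by factor.\<close>

lemma mset_tensor_superset:
  assumes "finite S" "set_mset M \<subseteq> S" "h \<in> S \<rightarrow> carrier G"
  shows "(\<Otimes>x\<in>set_mset M. h x [^] count M x) = (\<Otimes>x\<in>S. h x [^] count M x)"
  using assms by (intro finprod_mono_neutral_cong_left) (auto simp: not_in_iff)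

end

context comm_quantale
begin

lemma mset_tensor_closed:
  "h \<in> set_mset M \<rightarrow> carrier Q \<Longrightarrow> mset_tensor Q h M \<in> carrier Q"
  unfolding mset_tensor_def by (intro finprod_closed) auto

lemma mset_tensor_empty [simp]: "mset_tensor Q h {#} = \<one>"
  by (simp add: mset_tensor_def)

lemma mset_tensor_single [simp]: "h x \<in> carrier Q \<Longrightarrow> mset_tensor Q h {#x#} = h x"
  by (simp add: mset_tensor_def)

lemma mset_tensor_union:
  assumes "h \<in> set_mset (M + N) \<rightarrow> carrier Q"
  shows "mset_tensor Q h (M + N) = mset_tensor Q h M \<otimes> mset_tensor Q h N"
proof -
  let ?S = "set_mset (M + N)"
  have *: "mset_tensor Q h K = (\<Otimes>x\<in>?S. h x [^] count K x)" if "set_mset K \<subseteq> ?S" for K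
    unfolding mset_tensor_def by (rule mset_tensor_superset) (use assms that in auto)
  have "mset_tensor Q h (M + N) = (\<Otimes>x\<in>?S. h x [^] count M x \<otimes> h x [^] count N x)"
    unfolding mset_tensor_def
    by (intro finprod_cong') (use assms in \<open>auto simp: nat_pow_mult Pi_iff\<close>)
  also have "\<dots> = mset_tensor Q h M \<otimes> mset_tensor Q h N"
    using assms by (simp add: *[of M] *[of N] Pi_iff finprod_multf)
  finally show ?thesis .
qed

end

section \<open>Positions as a free commutative monoid, and their values\<close>

lemma positions_mono: "S \<subseteq> T \<Longrightarrow> positions S \<subseteq> positions T"
  by (auto simp: positions_def)

lemma positions_add [simp]: "p + q \<in> positions S \<longleftrightarrow> p \<in> positions S \<and> q \<in> positions S"
  by (auto simp: positions_def)

lemma positions_zero [simp]: "0 \<in> positions S"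
  by (simp add: positions_def)

lemma positions_single [simp]:
  "({#x#}, {#}) \<in> positions S \<longleftrightarrow> x \<in> S" "({#}, {#x#}) \<in> positions S \<longleftrightarrow> x \<in> S"
  "({#x#}, {#x#}) \<in> positions S \<longleftrightarrow> x \<in> S"
  "({#x, x#}, {#}) \<in> positions S \<longleftrightarrow> x \<in> S" "({#}, {#x, x#}) \<in> positions S \<longleftrightarrow> x \<in> S"
  by (auto simp: positions_def)

text \<open>Positions over S are freely generated by two copies of S, one for each side. This
  induction extends identities from generators to all positions.\<close>

lemma positions_induct [consumes 1, case_names zero pos neg]:
  assumes "p \<in> positions S"
    and "P 0"
    and pos: "\<And>x p. \<lbrakk>x \<in> S; p \<in> positions S; P p\<rbrakk> \<Longrightarrow> P (({#x#}, {#}) + p)"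
    and neg: "\<And>x p. \<lbrakk>x \<in> S; p \<in> positions S; P p\<rbrakk> \<Longrightarrow> P (({#}, {#x#}) + p)"
  shows "P p"
proof -
  have N: "P ({#}, N)" if "set_mset N \<subseteq> S" for N
    using that
  proof (induction N)
    case empty
    then show ?case using assms(2) by (simp add: zero_prod_def)
  next
    case (add x N)
    then show ?case using neg[of x "({#}, N)"] by (simp add: positions_def)
  qed
  have "P (M, N)" if "set_mset M \<subseteq> S" "set_mset N \<subseteq> S" for M N
    using that
  proof (induction M)
    case empty
    then show ?case using N by simp
  next
    case (add x M)
    then show ?case using pos[of x "(M, N)"] by (simp add: positions_def)
  qed
  then show ?thesis
    using assms(1) by (cases p) (simp add: positions_def)
qed

context comm_quantale
begin

lemma pos_value_closed:
  "p \<in> positions (carrier Q \<times> carrier Q) \<Longrightarrow> pos_value Q p \<in> carrier Q"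
  unfolding pos_value_def positions_def
  by (intro m_closed mset_tensor_closed) auto

lemma pos_value_zero [simp]: "pos_value Q 0 = \<one>"
  by (simp add: pos_value_def)

lemma pos_value_single [simp]:
  "\<lbrakk>fst x \<in> carrier Q\<rbrakk> \<Longrightarrow> pos_value Q ({#x#}, {#}) = fst x"
  "\<lbrakk>snd x \<in> carrier Q\<rbrakk> \<Longrightarrow> pos_value Q ({#}, {#x#}) = snd x"
  by (simp_all add: pos_value_def)

lemma pos_value_add:
  assumes p: "p \<in> positions (carrier Q \<times> carrier Q)" and q: "q \<in> positions (carrier Q \<times> carrier Q)"
  shows "pos_value Q (p + q) = pos_value Q p \<otimes> pos_value Q q"
proof -
  have "mset_tensor Q fst (fst p) \<in> carrier Q" "mset_tensor Q snd (snd p) \<in> carrier Q"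
    "mset_tensor Q fst (fst q) \<in> carrier Q" "mset_tensor Q snd (snd q) \<in> carrier Q"
    using p q by (auto intro!: mset_tensor_closed simp: positions_def)
  moreover have
    "mset_tensor Q fst (fst p + fst q) = mset_tensor Q fst (fst p) \<otimes> mset_tensor Q fst (fst q)"
    "mset_tensor Q snd (snd p + snd q) = mset_tensor Q snd (snd p) \<otimes> mset_tensor Q snd (snd q)"
    using p q by (auto intro!: mset_tensor_union simp: positions_def)
  ultimately show ?thesis
    by (simp add: pos_value_def m_ac)
qed

end

lemma map_pos_zero [simp]: "map_pos f 0 = 0"
  by (simp add: map_pos_def zero_prod_def)

lemma map_pos_add [simp]: "map_pos f (p + q) = map_pos f p + map_pos f q"
  by (simp add: map_pos_def prod_eq_iff)

lemma map_pos_single [simp]: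
  "map_pos f ({#x#}, {#}) = ({#f x#}, {#})" "map_pos f ({#}, {#x#}) = ({#}, {#f x#})"
  by (simp_all add: map_pos_def)

lemma map_pos_positions: "\<lbrakk>f ` S \<subseteq> T; p \<in> positions S\<rbrakk> \<Longrightarrow> map_pos f p \<in> positions T"
  by (fastforce simp: map_pos_def positions_def)

lemma map_pos_cong: "\<lbrakk>\<And>x. x \<in> S \<Longrightarrow> f x = g x; p \<in> positions S\<rbrakk> \<Longrightarrow> map_pos f p = map_pos g p"
  by (auto simp: map_pos_def positions_def prod_eq_iff intro!: image_mset_cong)

lemma map_pos_comp: "map_pos g (map_pos f p) = map_pos (g \<circ> f) p"
  by (simp add: map_pos_def prod_eq_iff multiset.map_comp)

lemma map_pos_id [simp]: "map_pos (\<lambda>x. x) p = p"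
  by (cases p) (simp add: map_pos_def)

text \<open>Both sides are monoid homomorphisms in p and agree on the generators.\<close>

lemma pos_value_map:
  assumes "comm_quantale P" "comm_quantale Q"
    and f: "f \<in> carrier P \<rightarrow> carrier Q" "f \<one>\<^bsub>P\<^esub> = \<one>\<^bsub>Q\<^esub>"
      "\<And>a b. \<lbrakk>a \<in> carrier P; b \<in> carrier P\<rbrakk> \<Longrightarrow> f (a \<otimes>\<^bsub>P\<^esub> b) = f a \<otimes>\<^bsub>Q\<^esub> f b"
    and p: "p \<in> positions (carrier P \<times> carrier P)"
  shows "pos_value Q (map_pos (map_prod f f) p) = f (pos_value P p)"
proof -
  interpret P: comm_quantale P by fact
  interpret Q: comm_quantale Q by fact
  have im: "map_prod f f ` (carrier P \<times> carrier P) \<subseteq> carrier Q \<times> carrier Q"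
    using f(1) by auto
  from p show ?thesis
  proof (induction rule: positions_induct)
    case zero
    then show ?case using f by simp
  next
    case (pos x p)
    then show ?case
      using f map_pos_positions[OF im, of p]
      by (subst P.pos_value_add)
         (auto simp: Q.pos_value_add P.pos_value_closed mem_Times_iff Pi_iff)
  next
    case (neg x p)
    then show ?case
      using f map_pos_positions[OF im, of p]
      by (subst P.pos_value_add)
         (auto simp: Q.pos_value_add P.pos_value_closed mem_Times_iff Pi_iff)
  qed
qed

section \<open>The quantale of closed sets of positions\<close>

text \<open>Otherwise the simplifier splits positions into pairs and takes sums of positions apart.\<close>

declare add_Pair [simp del] split_paired_All [simp del] split_paired_Ex [simp del]

section \<open>The polarity between sets of positions and its closure operator\<close>

abbreviation biperp :: "'x frame \<Rightarrow> 'x position set \<Rightarrow> 'x position set" where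
  "biperp X A \<equiv> perp X (perp X A)"

abbreviation sumset :: "'x position set \<Rightarrow> 'x position set \<Rightarrow> 'x position set" where
  "sumset A B \<equiv> {a + b | a b. a \<in> A \<and> b \<in> B}"

lemma mem_perp: "q \<in> perp X A \<longleftrightarrow> q \<in> positions (elts X) \<and> (\<forall>p\<in>A. p + q \<in> fbot X)"
  by (simp add: perp_def)

lemma perp_positions [simp, intro]: "perp X A \<subseteq> positions (elts X)"
  by (auto simp: mem_perp)

lemma perp_antimono: "A \<subseteq> B \<Longrightarrow> perp X B \<subseteq> perp X A"
  unfolding perp_def by blast

lemma biperp_mono: "A \<subseteq> B \<Longrightarrow> biperp X A \<subseteq> biperp X B"
  by (intro perp_antimono)

text \<open>Since 0 is neutral, orthogonality to 0 is membership in \<open>fbot X\<close>. Hence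
  \<open>fbot X\<close> is a closed set and can serve as an element of
  \<open>F_obj X\<close>.\<close>

lemma fbot_eq_perp: "frame X \<Longrightarrow> fbot X = perp X {0}"
  by (auto simp: mem_perp frame_def)

text \<open>Orthogonality is symmetric because addition of positions is commutative, so
  \<open>perp\<close> forms a Galois connection with itself.\<close>

lemma subset_perp_iff:
  assumes "A \<subseteq> positions (elts X)" "B \<subseteq> positions (elts X)"
  shows "A \<subseteq> perp X B \<longleftrightarrow> B \<subseteq> perp X A"
  using assms unfolding subset_iff mem_perp by (metis add.commute)

lemma subset_biperp: "A \<subseteq> positions (elts X) \<Longrightarrow> A \<subseteq> biperp X A"
  by (subst subset_perp_iff) auto

lemma perp_biperp [simp]: "A \<subseteq> positions (elts X) \<Longrightarrow> perp X (biperp X A) = perp X A"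
  by (intro equalityI perp_antimono subset_biperp) auto

lemma biperp_subset_iff:
  assumes "A \<subseteq> positions (elts X)" "biperp X C = C"
  shows "biperp X A \<subseteq> C \<longleftrightarrow> A \<subseteq> C"
  using assms subset_biperp[of A X] biperp_mono[of A C X] by auto

lemma perp_Union: "perp X (\<Union>\<A>) = positions (elts X) \<inter> (\<Inter>A\<in>\<A>. perp X A)"
  by (auto simp: mem_perp)

text \<open>\<open>perp\<close> turns unions into intersections and does not distinguish a set from
  its closure, so the inner closures disappear.\<close>

lemma biperp_Union:
  assumes "\<And>i. i \<in> I \<Longrightarrow> A i \<subseteq> positions (elts X)"
  shows "biperp X (\<Union>i\<in>I. biperp X (A i)) = biperp X (\<Union>i\<in>I. A i)"
  using assms by (simp add: perp_Union)

lemma sumset_positions: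
  "\<lbrakk>A \<subseteq> positions S; B \<subseteq> positions S\<rbrakk> \<Longrightarrow> sumset A B \<subseteq> positions S"
  by (blast intro: positions_add[THEN iffD2])

lemma sumset_commute: "sumset A B = sumset B A"
  using add.commute by blast

lemma sumset_assoc: "sumset (sumset A B) C = sumset A (sumset B C)"
  by (blast intro: add.assoc add.assoc[symmetric])

lemma mem_perp_sumset:
  "q \<in> perp X (sumset A B) \<longleftrightarrow> q \<in> positions (elts X) \<and> (\<forall>a\<in>A. \<forall>b\<in>B. a + b + q \<in> fbot X)"
  unfolding mem_perp by blast

text \<open>Residuation: B and q are moved to the other side, which leaves A only as the left side
  of an inclusion into an orthogonal.\<close>

lemma perp_sumset:
  assumes "A \<subseteq> positions (elts X)" "B \<subseteq> positions (elts X)"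
  shows "perp X (sumset A B) = {q \<in> positions (elts X). A \<subseteq> perp X (sumset B {q})}"
  using assms unfolding set_eq_iff mem_Collect_eq subset_iff mem_perp_sumset
  by (simp add: ac_simps) blast

text \<open>Orthogonals are closed, so the inclusion in \<open>perp_sumset\<close> holds for A iff
  it holds for the closure of A. This is the nucleus property that makes closed sets a
  quantale.\<close>

lemma perp_sumset_biperp_left:
  assumes A: "A \<subseteq> positions (elts X)" and B: "B \<subseteq> positions (elts X)"
  shows "perp X (sumset (biperp X A) B) = perp X (sumset A B)"
proof -
  have "biperp X A \<subseteq> perp X (sumset B {q}) \<longleftrightarrow> A \<subseteq> perp X (sumset B {q})"
    if "q \<in> positions (elts X)" for q
    using A B that by (intro biperp_subset_iff perp_biperp sumset_positions) auto
  then show ?thesis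
    using A B by (auto simp: perp_sumset)
qed

lemma perp_sumset_biperp_right:
  assumes "A \<subseteq> positions (elts X)" "B \<subseteq> positions (elts X)"
  shows "perp X (sumset A (biperp X B)) = perp X (sumset A B)"
  using perp_sumset_biperp_left[OF assms(2,1)] by (simp only: sumset_commute[of A])

section \<open>The closed sets as monoid, complete lattice and Girard quantale\<close>

lemma F_obj_simps [simp]:
  "A \<otimes>\<^bsub>F_obj X\<^esub> B = biperp X (sumset A B)"
  "\<one>\<^bsub>F_obj X\<^esub> = biperp X {0}"
  "qle (F_obj X) A B \<longleftrightarrow> A \<subseteq> B"
  "qbot (F_obj X) = fbot X"
  by (simp_all add: F_obj_def)

lemma carrier_F_obj: "A \<in> carrier (F_obj X) \<longleftrightarrow> A \<subseteq> positions (elts X) \<and> biperp X A = A"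
  by (simp add: F_obj_def)

lemma carrier_F_objD:
  assumes "A \<in> carrier (F_obj X)"
  shows "A \<subseteq> positions (elts X)" "biperp X A = A"
  using assms by (auto simp: carrier_F_obj)

lemma Union_carrier_F_obj: "\<A> \<subseteq> carrier (F_obj X) \<Longrightarrow> \<Union>\<A> \<subseteq> positions (elts X)"
  using carrier_F_objD(1) by blast

lemma perp_in_carrier [simp, intro]: "A \<subseteq> positions (elts X) \<Longrightarrow> perp X A \<in> carrier (F_obj X)"
  by (simp add: carrier_F_obj)

lemma biperp_in_carrier [simp, intro]: "biperp X A \<in> carrier (F_obj X)"
  by (rule perp_in_carrier) simp

text \<open>Closure is a homomorphism from sets of positions under \<open>sumset\<close> to
  \<open>F_obj X\<close>, which thereby inherits the monoid laws of \<open>sumset\<close>.\<close>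

lemma biperp_mult:
  assumes "A \<subseteq> positions (elts X)" "B \<subseteq> positions (elts X)"
  shows "biperp X A \<otimes>\<^bsub>F_obj X\<^esub> biperp X B = biperp X (sumset A B)"
  using assms by (simp only: F_obj_simps perp_sumset_biperp_left perp_sumset_biperp_right perp_positions)

lemma comm_monoid_F_obj: "comm_monoid (F_obj X)"
proof (rule comm_monoidI)
  fix A B C
  assume "A \<in> carrier (F_obj X)" "B \<in> carrier (F_obj X)" "C \<in> carrier (F_obj X)"
  then have *: "A \<subseteq> positions (elts X)" "B \<subseteq> positions (elts X)" "C \<subseteq> positions (elts X)"
    "biperp X A = A" "biperp X B = B" "biperp X C = C"
    by (auto simp: carrier_F_obj)
  have "A \<otimes>\<^bsub>F_obj X\<^esub> B \<otimes>\<^bsub>F_obj X\<^esub> C = biperp X (sumset (sumset A B) C)"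
    using * biperp_mult[of "sumset A B" X C] sumset_positions[of A "elts X" B] by simp
  moreover have "A \<otimes>\<^bsub>F_obj X\<^esub> (B \<otimes>\<^bsub>F_obj X\<^esub> C) = biperp X (sumset A (sumset B C))"
    using * biperp_mult[of A X "sumset B C"] sumset_positions[of B "elts X" C] by simp
  ultimately show "A \<otimes>\<^bsub>F_obj X\<^esub> B \<otimes>\<^bsub>F_obj X\<^esub> C = A \<otimes>\<^bsub>F_obj X\<^esub> (B \<otimes>\<^bsub>F_obj X\<^esub> C)"
    by (simp only: sumset_assoc)
next
  fix A assume A: "A \<in> carrier (F_obj X)"
  have "sumset {0} A = A" by auto
  then show "\<one>\<^bsub>F_obj X\<^esub> \<otimes>\<^bsub>F_obj X\<^esub> A = A"
    using A biperp_mult[of "{0}" X A] by (simp add: carrier_F_obj)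
next
  fix A B
  show "A \<otimes>\<^bsub>F_obj X\<^esub> B = B \<otimes>\<^bsub>F_obj X\<^esub> A"
    by (simp only: F_obj_simps sumset_commute)
qed auto

lemma qord_F_obj: "qord (F_obj X) = \<lparr>carrier = carrier (F_obj X), eq = (=), le = (\<subseteq>)\<rparr>"
  by (simp add: qord_def F_obj_def)

lemma partial_order_F_obj: "partial_order (qord (F_obj X))"
  unfolding qord_F_obj by unfold_locales auto

lemma lub_F_obj:
  assumes "\<A> \<subseteq> carrier (F_obj X)"
  shows "least (qord (F_obj X)) (biperp X (\<Union>\<A>)) (Upper (qord (F_obj X)) \<A>)"
proof (rule least_UpperI)
  have sub: "\<Union>\<A> \<subseteq> positions (elts X)"
    using assms by (rule Union_carrier_F_obj)
  show "A \<sqsubseteq>\<^bsub>qord (F_obj X)\<^esub> biperp X (\<Union>\<A>)" if "A \<in> \<A>" for A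
    using subset_biperp[OF sub] that by (auto simp: qord_F_obj)
  show "biperp X (\<Union>\<A>) \<sqsubseteq>\<^bsub>qord (F_obj X)\<^esub> B" if "B \<in> Upper (qord (F_obj X)) \<A>" for B
    using that assms biperp_subset_iff[OF sub, of B]
    by (auto simp: qord_F_obj Upper_def carrier_F_obj subset_iff)
qed (use assms in \<open>auto simp: qord_F_obj\<close>)

text \<open>Intersections of closed sets are closed. The factor \<open>positions (elts X)\<close>
  covers the empty family, whose intersection would otherwise be the whole type.\<close>

lemma glb_F_obj:
  assumes "\<A> \<subseteq> carrier (F_obj X)"
  shows "greatest (qord (F_obj X)) (positions (elts X) \<inter> \<Inter>\<A>) (Lower (qord (F_obj X)) \<A>)"
proof (rule greatest_LowerI)
  let ?I = "positions (elts X) \<inter> \<Inter>\<A>"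
  have "biperp X ?I \<subseteq> A" if "A \<in> \<A>" for A
  proof -
    have "biperp X ?I \<subseteq> biperp X A"
      using that by (intro biperp_mono) auto
    then show ?thesis
      using that assms carrier_F_objD(2) by blast
  qed
  then have "biperp X ?I \<subseteq> ?I"
    using perp_positions[of X "perp X ?I"] by blast
  then show "?I \<in> carrier (qord (F_obj X))"
    using subset_biperp[of ?I X] by (simp add: qord_F_obj carrier_F_obj set_eq_subset)
  show "B \<sqsubseteq>\<^bsub>qord (F_obj X)\<^esub> ?I" if "B \<in> Lower (qord (F_obj X)) \<A>" for B
    using that assms by (auto simp: qord_F_obj Lower_def dest: carrier_F_objD(1))
qed (use assms in \<open>auto simp: qord_F_obj\<close>)

lemma complete_lattice_F_obj: "complete_lattice (qord (F_obj X))"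
proof (rule partial_order.complete_latticeI[OF partial_order_F_obj])
  fix \<A> assume "\<A> \<subseteq> carrier (qord (F_obj X))"
  then have \<A>: "\<A> \<subseteq> carrier (F_obj X)"
    by (simp add: qord_def)
  show "\<exists>S. least (qord (F_obj X)) S (Upper (qord (F_obj X)) \<A>)"
    using lub_F_obj[OF \<A>] by blast
  show "\<exists>S. greatest (qord (F_obj X)) S (Lower (qord (F_obj X)) \<A>)"
    using glb_F_obj[OF \<A>] by blast
qed

text \<open>The supremum of HOL-Algebra is chosen by Hilbert's operator; antisymmetry makes least
  upper bounds unique, so the choice falls on the one from \<open>lub_F_obj\<close>.\<close>

lemma qjoin_F_obj: "\<A> \<subseteq> carrier (F_obj X) \<Longrightarrow> qjoin (F_obj X) \<A> = biperp X (\<Union>\<A>)"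
  unfolding qjoin_def sup_def
  by (rule some_equality)
    (erule lub_F_obj, erule partial_order.least_unique[OF partial_order_F_obj], erule lub_F_obj)

lemma comm_quantale_F_obj: "comm_quantale (F_obj X)"
proof (intro comm_quantale.intro comm_monoid_F_obj comm_quantale_axioms.intro)
  show "complete_lattice (qord (F_obj X))"
    by (rule complete_lattice_F_obj)
next
  fix A \<B> assume "A \<in> carrier (F_obj X)" and \<B>: "\<B> \<subseteq> carrier (F_obj X)"
  then have A: "A \<subseteq> positions (elts X)" and B: "\<And>B. B \<in> \<B> \<Longrightarrow> B \<subseteq> positions (elts X)"
    using carrier_F_objD(1) by blast+
  have "A \<otimes>\<^bsub>F_obj X\<^esub> qjoin (F_obj X) \<B> = biperp X (sumset A (\<Union>\<B>))"
    using A B by (simp add: qjoin_F_obj[OF \<B>] perp_sumset_biperp_right Sup_le_iff)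
  also have "sumset A (\<Union>\<B>) = (\<Union>B\<in>\<B>. sumset A B)"
    by blast
  also have "biperp X \<dots> = biperp X (\<Union>B\<in>\<B>. biperp X (sumset A B))"
    by (intro biperp_Union[symmetric] sumset_positions A B)
  also have "\<dots> = qjoin (F_obj X) ((\<lambda>B. A \<otimes>\<^bsub>F_obj X\<^esub> B) ` \<B>)"
    by (subst qjoin_F_obj) auto
  finally show "A \<otimes>\<^bsub>F_obj X\<^esub> qjoin (F_obj X) \<B> = \<dots>" .
qed

text \<open>The closed sets C whose tensor with A lies in \<open>fbot X\<close> are those contained
  in \<open>perp X A\<close>, which is itself closed and hence the largest. Double duality thus
  amounts to closedness.\<close>

lemma qdual_F_obj:
  assumes X: "frame X" and A: "A \<in> carrier (F_obj X)"
  shows "qdual (F_obj X) A = perp X A"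
proof -
  let ?\<C> = "{C \<in> carrier (F_obj X). C \<subseteq> perp X A}"
  have A': "A \<subseteq> positions (elts X)"
    using A by (simp add: carrier_F_obj)
  note bot = fbot_eq_perp[OF X]
  have "biperp X (sumset C A) \<subseteq> fbot X \<longleftrightarrow> C \<subseteq> perp X A" if "C \<in> carrier (F_obj X)" for C
  proof -
    have C: "C \<subseteq> positions (elts X)" using that by (simp add: carrier_F_obj)
    have "biperp X (sumset C A) \<subseteq> fbot X \<longleftrightarrow> sumset C A \<subseteq> fbot X"
      unfolding bot by (intro biperp_subset_iff sumset_positions C A' perp_biperp) auto
    also have "\<dots> \<longleftrightarrow> C \<subseteq> perp X A"
      using C unfolding subset_iff mem_perp mem_Collect_eq by (metis add.commute)
    finally show ?thesis .
  qed
  then have "{C \<in> carrier (F_obj X). qle (F_obj X) (C \<otimes>\<^bsub>F_obj X\<^esub> A) (qbot (F_obj X))} = ?\<C>"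
    by auto
  then have "qdual (F_obj X) A = biperp X (\<Union>?\<C>)"
    unfolding qdual_def by (simp add: qjoin_F_obj)
  also have "\<Union>?\<C> = perp X A"
    using A' by blast
  finally show ?thesis
    using A' by simp
qed

lemma girard_quantale_F_obj: "frame X \<Longrightarrow> girard_quantale (F_obj X)"
proof -
  assume X: "frame X"
  interpret comm_quantale "F_obj X" by (rule comm_quantale_F_obj)
  show ?thesis
  proof
    show "qbot (F_obj X) \<in> carrier (F_obj X)"
      using X by (simp add: fbot_eq_perp)
    show "qdual (F_obj X) (qdual (F_obj X) A) = A" if "A \<in> carrier (F_obj X)" for A
      using that by (simp add: qdual_F_obj[OF X] carrier_F_obj)
  qed
qed

text \<open>A set is the union of its singletons, so the closed sets generated by single positions
  are join-dense.\<close>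

lemma closed_eq_qjoin:
  assumes "A \<in> carrier (F_obj X)"
  shows "A = qjoin (F_obj X) ((\<lambda>p. biperp X {p}) ` A)"
proof -
  have "biperp X (\<Union>p\<in>A. biperp X {p}) = biperp X (\<Union>p\<in>A. {p})"
    using assms by (intro biperp_Union) (auto simp: carrier_F_obj)
  then show ?thesis
    using assms by (subst qjoin_F_obj) (auto simp: carrier_F_obj)
qed

section \<open>Idempotency of the closed sets generated by single positions\<close>

lemma idempotent_eltD:
  assumes "idempotent_elt X x" "q \<in> positions (elts X)"
  shows "({#x, x#}, {#}) + q \<in> fbot X \<longleftrightarrow> ({#x#}, {#}) + q \<in> fbot X"
    and "({#}, {#x, x#}) + q \<in> fbot X \<longleftrightarrow> ({#}, {#x#}) + q \<in> fbot X"
  using assms unfolding idempotent_elt_def set_eq_iff mem_perp by blast+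

text \<open>Idempotency is given for elements only and passes to positions generator by generator.
  The test position q is kept arbitrary because each step of the induction moves a generator from p
  into q.\<close>

lemma perp_double:
  assumes X: "X \<in> IFc" and p: "p \<in> positions (elts X)"
  shows "perp X {p + p} = perp X {p}"
proof -
  have "p + p + q \<in> fbot X \<longleftrightarrow> p + q \<in> fbot X" if "q \<in> positions (elts X)" for q
    using p that
  proof (induction arbitrary: q rule: positions_induct)
    case zero
    then show ?case by simp
  next
    case (pos x p)
    \<comment> \<open>Regrouping isolates the doubled generator. Idempotency of x contracts it
      against the test position \<open>p + p + q\<close>, and the induction hypothesis then
      contracts \<open>p + p\<close> with the surviving generator added to q.\<close>
    have "({#x#}, {#}) + p + (({#x#}, {#}) + p) + q = ({#x, x#}, {#}) + (p + p + q)"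
      by (simp add: ac_simps prod_eq_iff)
    then have "({#x#}, {#}) + p + (({#x#}, {#}) + p) + q \<in> fbot X \<longleftrightarrow>
        p + p + (({#x#}, {#}) + q) \<in> fbot X"
      using X pos idempotent_eltD(1)[of X x "p + p + q"] by (simp add: IFc_def ac_simps)
    also have "\<dots> \<longleftrightarrow> p + (({#x#}, {#}) + q) \<in> fbot X"
      using pos by (intro pos.IH) simp
    finally show ?case by (simp add: ac_simps)
  next
    case (neg x p)
    have "({#}, {#x#}) + p + (({#}, {#x#}) + p) + q = ({#}, {#x, x#}) + (p + p + q)"
      by (simp add: ac_simps prod_eq_iff)
    then have "({#}, {#x#}) + p + (({#}, {#x#}) + p) + q \<in> fbot X \<longleftrightarrow>
        p + p + (({#}, {#x#}) + q) \<in> fbot X"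
      using X neg idempotent_eltD(2)[of X x "p + p + q"] by (simp add: IFc_def ac_simps)
    also have "\<dots> \<longleftrightarrow> p + (({#}, {#x#}) + q) \<in> fbot X"
      using neg by (intro neg.IH) simp
    finally show ?case by (simp add: ac_simps)
  qed
  then show ?thesis
    by (auto simp: mem_perp)
qed

lemma biperp_single_mult:
  "\<lbrakk>p \<in> positions (elts X); q \<in> positions (elts X)\<rbrakk> \<Longrightarrow>
    biperp X {p} \<otimes>\<^bsub>F_obj X\<^esub> biperp X {q} = biperp X {p + q}"
  by (subst biperp_mult) (simp_all add: ex_simps[symmetric] del: ex_simps F_obj_simps)

text \<open>The join-dense family of \<open>closed_eq_qjoin\<close> consists of idempotents by
  \<open>perp_double\<close>.\<close>

lemma join_idempotent_F_obj:
  assumes X: "X \<in> IFc"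
  shows "join_idempotent_quantale (F_obj X)"
proof -
  interpret girard_quantale "F_obj X"
    using X by (intro girard_quantale_F_obj) (simp add: IFc_def)
  show ?thesis
  proof
    fix A assume A: "A \<in> carrier (F_obj X)"
    have "biperp X {p} \<otimes>\<^bsub>F_obj X\<^esub> biperp X {p} = biperp X {p}" if "p \<in> A" for p
      using that carrier_F_objD(1)[OF A] perp_double[OF X, of p]
      by (subst biperp_single_mult) auto
    then have "(\<lambda>p. biperp X {p}) ` A
        \<subseteq> {E \<in> carrier (F_obj X). E \<otimes>\<^bsub>F_obj X\<^esub> E = E}"
      by blast
    then show "\<exists>\<E> \<subseteq> {E \<in> carrier (F_obj X). E \<otimes>\<^bsub>F_obj X\<^esub> E = E}. A = qjoin (F_obj X) \<E>"
      using closed_eq_qjoin[OF A] by blast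
  qed
qed


section \<open>Functoriality of \<open>F\<close>\<close>

text \<open>A and its closure have the same orthogonal; the second condition on frame morphisms,
  used in both directions, transports this equality along f.\<close>

lemma perp_map_biperp:
  assumes f: "f \<in> if_hom X Y" and A: "A \<subseteq> positions (elts X)"
  shows "perp Y (map_pos f ` biperp X A) = perp Y (map_pos f ` A)"
  using f A by (intro equalityI) (auto simp: if_hom_def)

lemma if_hom_image: "f \<in> if_hom X Y \<Longrightarrow> f ` elts X \<subseteq> elts Y"
  by (auto simp: if_hom_def)

lemma map_pos_image_positions:
  "\<lbrakk>f \<in> if_hom X Y; A \<subseteq> positions (elts X)\<rbrakk> \<Longrightarrow> map_pos f ` A \<subseteq> positions (elts Y)"
  using if_hom_image map_pos_positions by fastforce

lemma F_map_biperp: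
  assumes "f \<in> if_hom X Y" "A \<subseteq> positions (elts X)"
  shows "F_map X Y f (biperp X A) = biperp Y (map_pos f ` A)"
  using assms by (simp add: F_map_def perp_map_biperp)

lemma map_pos_sumset: "map_pos f ` sumset A B = sumset (map_pos f ` A) (map_pos f ` B)"
proof (intro equalityI subsetI)
  fix p assume "p \<in> map_pos f ` sumset A B"
  then show "p \<in> sumset (map_pos f ` A) (map_pos f ` B)"
    by (force simp: image_iff)
next
  fix p assume "p \<in> sumset (map_pos f ` A) (map_pos f ` B)"
  then obtain a b where "a \<in> A" "b \<in> B" "p = map_pos f (a + b)"
    by auto
  then show "p \<in> map_pos f ` sumset A B"
    by blast
qed

text \<open>By \<open>F_map_biperp\<close> a closure taken before f is absorbed by the one taken
  after it, so the laws for joins, tensor and unit reduce to images under \<open>map_pos f\<close>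
  commuting with unions, sums and 0.\<close>

lemma F_map_hom:
  assumes X: "frame X" and Y: "frame Y" and f: "f \<in> if_hom X Y"
  shows "F_map X Y f \<in> gq_hom (F_obj X) (F_obj Y)"
  unfolding gq_hom_def mem_Collect_eq
proof (intro conjI allI ballI impI)
  show "F_map X Y f \<in> carrier (F_obj X) \<rightarrow>\<^sub>E carrier (F_obj Y)"
    by (auto simp: F_map_def)
next
  fix \<A> assume \<A>: "\<A> \<subseteq> carrier (F_obj X)"
  then have A: "A \<subseteq> positions (elts X)" if "A \<in> \<A>" for A
    using that carrier_F_objD(1) by blast
  have "F_map X Y f (qjoin (F_obj X) \<A>) = biperp Y (map_pos f ` \<Union>\<A>)"
    using A f by (auto simp: qjoin_F_obj[OF \<A>] F_map_biperp Sup_le_iff)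
  also have "\<dots> = biperp Y (\<Union>A\<in>\<A>. biperp Y (map_pos f ` A))"
    unfolding image_Union
    by (rule biperp_Union[symmetric]) (use A map_pos_image_positions[OF f] in blast)
  also have "\<dots> = qjoin (F_obj Y) (F_map X Y f ` \<A>)"
    using \<A> by (subst qjoin_F_obj) (auto simp: F_map_def subset_iff)
  finally show "F_map X Y f (qjoin (F_obj X) \<A>) = qjoin (F_obj Y) (F_map X Y f ` \<A>)" .
next
  fix A B assume AB: "A \<in> carrier (F_obj X)" "B \<in> carrier (F_obj X)"
  then have AB': "A \<subseteq> positions (elts X)" "B \<subseteq> positions (elts X)"
    by (auto simp: carrier_F_obj)
  have "F_map X Y f (A \<otimes>\<^bsub>F_obj X\<^esub> B) = biperp Y (sumset (map_pos f ` A) (map_pos f ` B))"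
    using F_map_biperp[OF f sumset_positions[OF AB']] by (simp only: F_obj_simps map_pos_sumset)
  also have "\<dots> = F_map X Y f A \<otimes>\<^bsub>F_obj Y\<^esub> F_map X Y f B"
    using AB AB' f by (subst biperp_mult[symmetric])
      (simp_all only: F_map_def restrict_apply' map_pos_image_positions)
  finally show "F_map X Y f (A \<otimes>\<^bsub>F_obj X\<^esub> B) = F_map X Y f A \<otimes>\<^bsub>F_obj Y\<^esub> F_map X Y f B" .
next
  show "F_map X Y f \<one>\<^bsub>F_obj X\<^esub> = \<one>\<^bsub>F_obj Y\<^esub>"
    using f by (simp add: F_map_biperp)
next
  have "biperp Y (map_pos f ` fbot X) \<subseteq> biperp Y (fbot Y)"
    using f by (intro biperp_mono) (auto simp: if_hom_def)
  then show "qle (F_obj Y) (F_map X Y f (qbot (F_obj X))) (qbot (F_obj Y))"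
    by (simp add: F_map_def fbot_eq_perp X Y)
qed

lemma F_map_id:
  "F_map X X (\<lambda>x\<in>elts X. x) = (\<lambda>A\<in>carrier (F_obj X). A)"
proof (intro ext)
  fix A
  have "map_pos (\<lambda>x\<in>elts X. x) ` A = A" if "A \<subseteq> positions (elts X)"
    using that map_pos_cong[of "elts X" "\<lambda>x\<in>elts X. x" "\<lambda>x. x"] by (force simp: subset_iff)
  then show "F_map X X (\<lambda>x\<in>elts X. x) A = (\<lambda>A\<in>carrier (F_obj X). A) A"
    by (auto simp: F_map_def carrier_F_obj restrict_def)
qed

lemma map_pos_compose_image:
  assumes "A \<subseteq> positions (elts X)"
  shows "map_pos (compose (elts X) g f) ` A = map_pos g ` map_pos f ` A"
  unfolding image_image map_pos_comp
  by (intro image_cong map_pos_cong[of "elts X"]) (use assms in \<open>auto simp: compose_def\<close>)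

text \<open>The intermediate closure in Y is absorbed by \<open>F_map_biperp\<close> for g.\<close>

lemma F_map_compose:
  assumes f: "f \<in> if_hom X Y" and g: "g \<in> if_hom Y Z"
  shows "F_map X Z (compose (elts X) g f) = compose (carrier (F_obj X)) (F_map Y Z g) (F_map X Y f)"
proof (intro ext)
  fix A
  show "F_map X Z (compose (elts X) g f) A =
      compose (carrier (F_obj X)) (F_map Y Z g) (F_map X Y f) A"
  proof (cases "A \<in> carrier (F_obj X)")
    case True
    then have A: "A \<subseteq> positions (elts X)" by (simp add: carrier_F_obj)
    have "F_map X Z (compose (elts X) g f) A = biperp Z (map_pos g ` map_pos f ` A)"
      using True A by (simp add: F_map_def map_pos_compose_image)
    then show ?thesis
      using True F_map_biperp[OF g map_pos_image_positions[OF f A]]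
      by (simp add: compose_def F_map_def[of X Y])
  qed (simp add: F_map_def compose_def)
qed

lemma if_homD:
  assumes "f \<in> if_hom X Y"
  shows "f \<in> elts X \<rightarrow>\<^sub>E elts Y" "map_pos f ` fbot X \<subseteq> fbot Y"
    and "\<And>A B. \<lbrakk>A \<subseteq> positions (elts X); B \<subseteq> positions (elts X); perp X A \<subseteq> perp X B\<rbrakk> \<Longrightarrow>
      perp Y (map_pos f ` A) \<subseteq> perp Y (map_pos f ` B)"
  using assms by (simp_all add: if_hom_def)

lemma if_hom_compose:
  assumes f: "f \<in> if_hom X Y" and g: "g \<in> if_hom Y Z" and X: "frame X"
  shows "compose (elts X) g f \<in> if_hom X Z"
  unfolding if_hom_def mem_Collect_eq
proof (intro conjI allI impI)
  show "compose (elts X) g f \<in> elts X \<rightarrow>\<^sub>E elts Z"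
    using f g by (auto simp: if_hom_def compose_def)
  have "map_pos (compose (elts X) g f) ` fbot X = map_pos g ` map_pos f ` fbot X"
    using X by (intro map_pos_compose_image) (simp add: frame_def)
  also have "\<dots> \<subseteq> fbot Z"
    using if_homD(2)[OF f] if_homD(2)[OF g] image_mono by (meson order_trans)
  finally show "map_pos (compose (elts X) g f) ` fbot X \<subseteq> fbot Z" .
next
  fix A B
  assume AB: "A \<subseteq> positions (elts X)" "B \<subseteq> positions (elts X)" "perp X A \<subseteq> perp X B"
  then have "perp Y (map_pos f ` A) \<subseteq> perp Y (map_pos f ` B)"
    by (intro if_homD(3)[OF f])
  then have "perp Z (map_pos g ` map_pos f ` A) \<subseteq> perp Z (map_pos g ` map_pos f ` B)"
    using AB by (intro if_homD(3)[OF g] map_pos_image_positions[OF f])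
  then show "perp Z (map_pos (compose (elts X) g f) ` A)
      \<subseteq> perp Z (map_pos (compose (elts X) g f) ` B)"
    using AB by (simp add: map_pos_compose_image)
qed


section \<open>The frame of a Girard quantale\<close>

definition value_frame :: "'a quantale \<Rightarrow> ('a \<times> 'a) set \<Rightarrow> ('a \<times> 'a) frame" where
  "value_frame Q S = \<lparr>elts = S, fbot = {p \<in> positions S. qle Q (pos_value Q p) (qbot Q)}\<rparr>"

lemma elts_value_frame [simp]: "elts (value_frame Q S) = S"
  by (simp add: value_frame_def)

lemma fbot_value_frame:
  "p \<in> fbot (value_frame Q S) \<longleftrightarrow> p \<in> positions S \<and> qle Q (pos_value Q p) (qbot Q)"
  by (simp add: value_frame_def)

lemma U_obj_eq: "U_obj Q = value_frame Q (U_elts Q)"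
  by (simp add: U_obj_def value_frame_def pos_value_def)

lemma elts_Uc_subset: "elts (Uc_obj Q) \<subseteq> U_elts Q"
  by (auto simp: Uc_obj_def restrict_frame_def U_obj_def)

lemma Uc_obj_eq: "Uc_obj Q = value_frame Q (elts (Uc_obj Q))"
proof -
  have "fbot (Uc_obj Q) = fbot (U_obj Q) \<inter> positions (elts (Uc_obj Q))"
    by (simp add: Uc_obj_def restrict_frame_def)
  also have "\<dots> = fbot (value_frame Q (elts (Uc_obj Q)))"
    using positions_mono[OF elts_Uc_subset[of Q]] by (auto simp: U_obj_eq fbot_value_frame)
  finally show ?thesis
    by (simp add: value_frame_def)
qed

lemma fbot_Uc_obj:
  "p \<in> fbot (Uc_obj Q) \<longleftrightarrow> p \<in> positions (elts (Uc_obj Q)) \<and> qle Q (pos_value Q p) (qbot Q)"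
  by (subst Uc_obj_eq) (simp only: fbot_value_frame)

lemma U_elts_subset: "U_elts Q \<subseteq> carrier Q \<times> carrier Q"
  by (auto simp: U_elts_def)

lemma elts_Uc_carrier: "elts (Uc_obj Q) \<subseteq> carrier Q \<times> carrier Q"
  using elts_Uc_subset U_elts_subset by blast

lemma perp_restrict_frame:
  assumes "S \<subseteq> elts X" "A \<subseteq> positions S"
  shows "perp (restrict_frame X S) A = perp X A \<inter> positions S"
proof -
  have "q \<in> perp (restrict_frame X S) A \<longleftrightarrow> q \<in> perp X A \<inter> positions S" for q
    using assms positions_mono[OF assms(1)] by (auto simp: mem_perp restrict_frame_def)
  then show ?thesis
    by blast
qed

text \<open>For sets of positions over S, restriction to S merely intersects orthogonals with
  \<open>positions S\<close>. The equations between orthogonals that express idempotency and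
  containment therefore survive it.\<close>

lemma Uc_obj_IFc: "Uc_obj Q \<in> IFc"
proof -
  define S where "S = {x \<in> elts (U_obj Q). idempotent_elt (U_obj Q) x \<and> containment_elt (U_obj Q) x}"
  have S: "S \<subseteq> elts (U_obj Q)"
    by (auto simp: S_def)
  have Uc: "Uc_obj Q = restrict_frame (U_obj Q) S"
    by (simp add: Uc_obj_def S_def)
  have elts: "elts (restrict_frame (U_obj Q) S) = S"
    by (simp add: restrict_frame_def)
  have "idempotent_elt (restrict_frame (U_obj Q) S) x \<and> containment_elt (restrict_frame (U_obj Q) S) x"
    if "x \<in> S" for x
  proof -
    have "idempotent_elt (U_obj Q) x" "containment_elt (U_obj Q) x"
      using that by (auto simp: S_def)
    then show ?thesis
      using that positions_mono[OF S] unfolding idempotent_elt_def containment_elt_def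
      by (simp add: perp_restrict_frame[OF S] elts Int_absorb1)
  qed
  then show ?thesis
    by (auto simp: IFc_def Uc elts frame_def restrict_frame_def)
qed

section \<open>Orthogonality in terms of values, and the elements of the frame
  \<open>Uc_obj Q\<close>\<close>

context comm_quantale
begin

lemma pos_values_closed:
  assumes "S \<subseteq> carrier Q \<times> carrier Q" "A \<subseteq> positions S"
  shows "pos_value Q ` A \<subseteq> carrier Q"
  using assms positions_mono[OF assms(1)] pos_value_closed by blast

text \<open>The tensor distributes over joins, so testing q against every member of A is a single
  test against the join of their values. The orthogonal of A depends on A only through this
  join.\<close>

lemma mem_perp_value_frame:
  assumes S: "S \<subseteq> carrier Q \<times> carrier Q" and A: "A \<subseteq> positions S" and bot: "qbot Q \<in> carrier Q"
  shows "q \<in> perp (value_frame Q S) A \<longleftrightarrow>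
    q \<in> positions S \<and> qjoin Q (pos_value Q ` A) \<otimes> pos_value Q q \<preceq> qbot Q"
proof (cases "q \<in> positions S")
  case True
  note S' = positions_mono[OF S]
  have v: "pos_value Q q \<in> carrier Q"
    using True S' by (auto intro: pos_value_closed)
  have sum: "\<forall>p\<in>A. pos_value Q (p + q) \<in> carrier Q"
    using True A S' by (intro ballI pos_value_closed) auto
  have "qjoin Q (pos_value Q ` A) \<otimes> pos_value Q q
      = qjoin Q ((\<lambda>a. pos_value Q q \<otimes> a) ` pos_value Q ` A)"
    using v pos_values_closed[OF S A] by (simp add: m_comm[of _ "pos_value Q q"] distrib)
  also have "(\<lambda>a. pos_value Q q \<otimes> a) ` pos_value Q ` A = (\<lambda>p. pos_value Q (p + q)) ` A"
   
    unfolding image_image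
  proof (rule image_cong[OF refl])
    fix p assume "p \<in> A"
    then have "p \<in> positions (carrier Q \<times> carrier Q)" "q \<in> positions (carrier Q \<times> carrier Q)"
      using True A S' by auto
    then show "pos_value Q q \<otimes> pos_value Q p = pos_value Q (p + q)"
      by (simp add: pos_value_add pos_value_closed m_comm)
  qed
  finally have "qjoin Q (pos_value Q ` A) \<otimes> pos_value Q q \<preceq> qbot Q \<longleftrightarrow>
      (\<forall>p\<in>A. pos_value Q (p + q) \<preceq> qbot Q)"
    using sum bot by (simp add: qjoin_le_iff image_subset_iff)
  then show ?thesis
    using True A by (auto simp: mem_perp fbot_value_frame)
qed (simp add: mem_perp)

end

context girard_quantale
begin

text \<open>Every c is thereby the value of a one-element position of \<open>U_obj Q\<close>, so
  orthogonals in this frame see all test elements of the polarity.\<close>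

lemma dual_pair_in_U: "c \<in> carrier Q \<Longrightarrow> (c, qdual Q c) \<in> U_elts Q"
  by (simp add: U_elts_def mult_dual_le)

lemma mem_perp_U:
  assumes "p \<in> positions (U_elts Q)"
  shows "q \<in> perp (U_obj Q) {p} \<longleftrightarrow>
    q \<in> positions (U_elts Q) \<and> pos_value Q p \<otimes> pos_value Q q \<preceq> qbot Q"
  using assms pos_values_closed[OF U_elts_subset, of "{p}"]
  unfolding U_obj_eq by (subst mem_perp_value_frame) (auto simp: U_elts_subset)

lemma bot_iff_perp_U:
  assumes "p \<in> positions (U_elts Q)" "c \<in> carrier Q"
  shows "pos_value Q p \<otimes> c \<preceq> qbot Q \<longleftrightarrow> ({#(c, qdual Q c)#}, {#}) \<in> perp (U_obj Q) {p}"
  using assms by (simp add: mem_perp_U dual_pair_in_U)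

lemma pos_value_U_closed: "p \<in> positions (U_elts Q) \<Longrightarrow> pos_value Q p \<in> carrier Q"
  using positions_mono[OF U_elts_subset] pos_value_closed by blast

lemma perp_U_eq_iff:
  assumes p: "p \<in> positions (U_elts Q)" and q: "q \<in> positions (U_elts Q)"
  shows "perp (U_obj Q) {p} = perp (U_obj Q) {q} \<longleftrightarrow> pos_value Q p = pos_value Q q"
proof
  assume "perp (U_obj Q) {p} = perp (U_obj Q) {q}"
  then show "pos_value Q p = pos_value Q q"
    using p q by (intro eqI_bot) (simp_all add: pos_value_U_closed bot_iff_perp_U)
next
  assume "pos_value Q p = pos_value Q q"
  then have "r \<in> perp (U_obj Q) {p} \<longleftrightarrow> r \<in> perp (U_obj Q) {q}" for r
    using p q by (simp add: mem_perp_U)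
  then show "perp (U_obj Q) {p} = perp (U_obj Q) {q}"
    by blast
qed

text \<open>A value that stays below \<open>qbot Q\<close> when tensored with any c lies below the
  least element by \<open>leI_bot\<close>; conversely, the least element absorbs every
  tensor.\<close>

lemma perp_U_full_iff:
  assumes p: "p \<in> positions (U_elts Q)"
  shows "perp (U_obj Q) {p} = positions (U_elts Q) \<longleftrightarrow> pos_value Q p = qjoin Q {}"
proof
  assume *: "perp (U_obj Q) {p} = positions (U_elts Q)"
  have "pos_value Q p \<preceq> qjoin Q {}"
  proof (rule leI_bot)
    show "pos_value Q p \<otimes> c \<preceq> qbot Q" if "c \<in> carrier Q" for c
      using that p by (simp add: bot_iff_perp_U * dual_pair_in_U)
  qed (use p pos_value_U_closed in auto)
  then show "pos_value Q p = qjoin Q {}"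
    using p pos_value_U_closed zero_least by (simp add: qle_antisym)
next
  assume "pos_value Q p = qjoin Q {}"
  then have "r \<in> perp (U_obj Q) {p} \<longleftrightarrow> r \<in> positions (U_elts Q)" for r
    using p by (auto simp: mem_perp_U mult_zero pos_value_U_closed zero_least)
  then show "perp (U_obj Q) {p} = positions (U_elts Q)"
    by blast
qed

text \<open>\<open>perp_U_eq_iff\<close> and \<open>perp_U_full_iff\<close> translate the conditions
  on orthogonals into equations between values. The resulting description is purely algebraic and
  hence easy to transport along morphisms.\<close>

lemma elts_Uc_obj:
  "(a, b) \<in> elts (Uc_obj Q) \<longleftrightarrow>
    a \<in> carrier Q \<and> b \<in> carrier Q \<and> a \<otimes> a = a \<and> b \<otimes> b = b \<and> a \<otimes> b = qjoin Q {}"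
proof -
  let ?x = "(a, b)"
  have "idempotent_elt (U_obj Q) ?x \<longleftrightarrow> a \<otimes> a = a \<and> b \<otimes> b = b"
    and "containment_elt (U_obj Q) ?x \<longleftrightarrow> a \<otimes> b = qjoin Q {}" if x: "?x \<in> U_elts Q"
  proof -
    have ab: "a \<in> carrier Q" "b \<in> carrier Q" using x by (auto simp: U_elts_def)
    \<comment> \<open>Splitting into generators lets \<open>pos_value_add\<close> compute the
      values.\<close>
    have sum: "({#?x, ?x#}, {#}) = ({#?x#}, {#}) + ({#?x#}, {#})"
      "({#}, {#?x, ?x#}) = ({#}, {#?x#}) + ({#}, {#?x#})"
      "({#?x#}, {#?x#}) = ({#?x#}, {#}) + ({#}, {#?x#})"
      by (simp_all add: prod_eq_iff)
    have val: "pos_value Q ({#?x, ?x#}, {#}) = a \<otimes> a" "pos_value Q ({#}, {#?x, ?x#}) = b \<otimes> b"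
      "pos_value Q ({#?x#}, {#?x#}) = a \<otimes> b"
      unfolding sum using ab by (simp_all add: pos_value_add)
    show "idempotent_elt (U_obj Q) ?x \<longleftrightarrow> a \<otimes> a = a \<and> b \<otimes> b = b"
      unfolding idempotent_elt_def using x ab by (subst (1 2) perp_U_eq_iff) (auto simp: val)
    have "elts (U_obj Q) = U_elts Q" by (simp add: U_obj_eq)
    then show "containment_elt (U_obj Q) ?x \<longleftrightarrow> a \<otimes> b = qjoin Q {}"
      unfolding containment_elt_def using x by (simp add: perp_U_full_iff val)
  qed
  \<comment> \<open>The inequality that defines \<open>U_elts\<close> follows from the vanishing of
    the tensor, since zero lies below \<open>qbot Q\<close>.\<close>
  moreover have "?x \<in> U_elts Q" if "a \<in> carrier Q" "b \<in> carrier Q" "a \<otimes> b = qjoin Q {}"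
    using that by (simp add: U_elts_def zero_least)
  ultimately show ?thesis
    by (auto simp: Uc_obj_def restrict_frame_def U_obj_eq U_elts_def)
qed

end

text \<open>An idempotent \<open>e\<close> is the value of the position \<open>({\<langle>e, 0\<rangle>}, \<emptyset>)\<close> of \<open>U\<^sup>c Q\<close>,
  so join-idempotency makes the values of positions join-dense.\<close>

lemma (in join_idempotent_quantale) perp_Uc_subset_iff:
  assumes A: "A \<subseteq> positions (elts (Uc_obj Q))" and B: "B \<subseteq> positions (elts (Uc_obj Q))"
  shows "perp (Uc_obj Q) A \<subseteq> perp (Uc_obj Q) B \<longleftrightarrow>
    qjoin Q (pos_value Q ` B) \<preceq> qjoin Q (pos_value Q ` A)"
proof -
  note mem = mem_perp_value_frame[OF elts_Uc_carrier, folded Uc_obj_eq, OF _ bot_closed]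
  have a: "qjoin Q (pos_value Q ` A) \<in> carrier Q" and b: "qjoin Q (pos_value Q ` B) \<in> carrier Q"
    using A B pos_values_closed[OF elts_Uc_carrier] by blast+
  show ?thesis
  proof
    assume sub: "perp (Uc_obj Q) A \<subseteq> perp (Uc_obj Q) B"
    show "qjoin Q (pos_value Q ` B) \<preceq> qjoin Q (pos_value Q ` A)"
    proof (rule leI_bot_idem[OF b a])
      fix e assume e: "e \<in> carrier Q" "e \<otimes> e = e" "qjoin Q (pos_value Q ` A) \<otimes> e \<preceq> qbot Q"
      \<comment> \<open>The second component has to be idempotent and to annihilate e; zero does
        both and leaves e as the value of the position.\<close>
      let ?p = "({#(e, qjoin Q {})#}, {#})"
      have "(e, qjoin Q {}) \<in> elts (Uc_obj Q)"
        using e by (simp add: elts_Uc_obj mult_zero m_comm[of e "qjoin Q {}"])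
      then have "?p \<in> perp (Uc_obj Q) A"
        using e by (simp add: mem[OF A])
      then have "?p \<in> perp (Uc_obj Q) B"
        using sub by blast
      then show "qjoin Q (pos_value Q ` B) \<otimes> e \<preceq> qbot Q"
        using e by (simp add: mem[OF B])
    qed
  next
    assume le: "qjoin Q (pos_value Q ` B) \<preceq> qjoin Q (pos_value Q ` A)"
    show "perp (Uc_obj Q) A \<subseteq> perp (Uc_obj Q) B"
    proof
      fix q assume q: "q \<in> perp (Uc_obj Q) A"
      then have v: "pos_value Q q \<in> carrier Q"
        using pos_values_closed[OF elts_Uc_carrier, of "{q}"] by (simp add: mem_perp)
      have "qjoin Q (pos_value Q ` B) \<otimes> pos_value Q q \<preceq> qjoin Q (pos_value Q ` A) \<otimes> pos_value Q q"
        using mult_mono[OF le v b a] a b v by (simp add: m_comm)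
      then show "q \<in> perp (Uc_obj Q) B"
        using q a b v by (auto simp: mem[OF A] mem[OF B] intro: qle_trans)
    qed
  qed
qed


section \<open>Functoriality of \<open>U\<^sup>c\<close>\<close>

lemma gq_homD:
  assumes "f \<in> gq_hom P Q"
  shows "f \<in> carrier P \<rightarrow>\<^sub>E carrier Q" "f \<in> carrier P \<rightarrow> carrier Q"
    and "\<And>A. A \<subseteq> carrier P \<Longrightarrow> f (qjoin P A) = qjoin Q (f ` A)"
    and "\<And>a b. \<lbrakk>a \<in> carrier P; b \<in> carrier P\<rbrakk> \<Longrightarrow> f (a \<otimes>\<^bsub>P\<^esub> b) = f a \<otimes>\<^bsub>Q\<^esub> f b"
    and "f \<one>\<^bsub>P\<^esub> = \<one>\<^bsub>Q\<^esub>" "qle Q (f (qbot P)) (qbot Q)"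
  using assms by (auto simp: gq_hom_def)

lemma gq_hom_mono:
  assumes "comm_quantale P" "comm_quantale Q" "f \<in> gq_hom P Q"
    and "qle P a b" "a \<in> carrier P" "b \<in> carrier P"
  shows "qle Q (f a) (f b)"
proof -
  interpret P: comm_quantale P by fact
  interpret Q: comm_quantale Q by fact
  note f = gq_homD[OF assms(3)]
  have "qjoin P {a, b} = b"
    using assms by (intro P.qjoin_eqI) (auto intro: P.qle_trans)
  then have "f b = qjoin Q {f a, f b}"
    using f(3)[of "{a, b}"] assms by simp
  then show ?thesis
    using Q.qjoin_upper[of "{f a, f b}" "f a"] f(2) assms by auto
qed

lemma Uc_map_apply: "x \<in> elts (Uc_obj P) \<Longrightarrow> Uc_map P Q f x = map_prod f f x"
  using elts_Uc_subset by (fastforce simp: Uc_map_def U_map_def U_obj_def)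

text \<open>The description in \<open>elts_Uc_obj\<close> consists of equations between tensors and
  the empty join, all of which f preserves.\<close>

lemma Uc_map_elts:
  assumes "girard_quantale P" "girard_quantale Q" and f: "f \<in> gq_hom P Q"
    and x: "x \<in> elts (Uc_obj P)"
  shows "map_prod f f x \<in> elts (Uc_obj Q)"
proof -
  interpret P: girard_quantale P by fact
  interpret Q: girard_quantale Q by fact
  obtain a b where [simp]: "x = (a, b)" by (cases x)
  note ab = x[simplified, unfolded P.elts_Uc_obj]
  have "f a \<in> carrier Q" "f b \<in> carrier Q"
    using ab gq_homD(2)[OF f] by auto
  moreover have "f a \<otimes>\<^bsub>Q\<^esub> f a = f a" "f b \<otimes>\<^bsub>Q\<^esub> f b = f b" "f a \<otimes>\<^bsub>Q\<^esub> f b = qjoin Q {}"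
    using ab gq_homD(4)[OF f, symmetric] gq_homD(3)[OF f, of "{}"] by simp_all
  ultimately show ?thesis
    by (simp add: Q.elts_Uc_obj)
qed

lemma pos_value_Uc_map:
  assumes "comm_quantale P" "comm_quantale Q" "f \<in> gq_hom P Q"
    and p: "p \<in> positions (elts (Uc_obj P))"
  shows "pos_value Q (map_pos (Uc_map P Q f) p) = f (pos_value P p)"
proof -
  have "map_pos (Uc_map P Q f) p = map_pos (map_prod f f) p"
    using p by (intro map_pos_cong[of "elts (Uc_obj P)"] Uc_map_apply)
  then show ?thesis
    using p assms gq_homD[OF assms(3)] positions_mono[OF elts_Uc_carrier[of P]]
    by (auto intro!: pos_value_map)
qed

text \<open>Taking values commutes with f, so \<open>perp_Uc_subset_iff\<close> on both sides turns
  the condition on orthogonals into monotonicity of f on joins. The condition on \<open>fbot\<close>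
  comes from monotonicity and the inequality for \<open>qbot\<close>.\<close>

lemma Uc_map_hom:
  assumes "join_idempotent_quantale P" "join_idempotent_quantale Q" and f: "f \<in> gq_hom P Q"
  shows "Uc_map P Q f \<in> if_hom (Uc_obj P) (Uc_obj Q)"
proof -
  interpret P: join_idempotent_quantale P by fact
  interpret Q: join_idempotent_quantale Q by fact
  note val = pos_value_Uc_map[OF P.comm_quantale_axioms Q.comm_quantale_axioms f]
  have elts: "Uc_map P Q f x \<in> elts (Uc_obj Q)" if "x \<in> elts (Uc_obj P)" for x
    using that Uc_map_elts[OF P.girard_quantale_axioms Q.girard_quantale_axioms f that]
    by (simp add: Uc_map_apply)
  then have pos: "map_pos (Uc_map P Q f) p \<in> positions (elts (Uc_obj Q))"
    if "p \<in> positions (elts (Uc_obj P))" for p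
    using that by (intro map_pos_positions) auto
  have closed: "pos_value P ` A \<subseteq> carrier P" if "A \<subseteq> positions (elts (Uc_obj P))" for A
    using that by (rule P.pos_values_closed[OF elts_Uc_carrier])
  have join: "qjoin Q (pos_value Q ` map_pos (Uc_map P Q f) ` A) = f (qjoin P (pos_value P ` A))"
    if "A \<subseteq> positions (elts (Uc_obj P))" for A
  proof -
    have "pos_value Q ` map_pos (Uc_map P Q f) ` A = f ` pos_value P ` A"
      unfolding image_image using that by (intro image_cong) (auto simp: val)
    then show ?thesis
      using gq_homD(3)[OF f closed[OF that]] by simp
  qed
  show ?thesis
    unfolding if_hom_def mem_Collect_eq
  proof (intro conjI allI impI)
    show "Uc_map P Q f \<in> elts (Uc_obj P) \<rightarrow>\<^sub>E elts (Uc_obj Q)"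
      using elts by (auto simp: Uc_map_def)
    show "map_pos (Uc_map P Q f) ` fbot (Uc_obj P) \<subseteq> fbot (Uc_obj Q)"
    proof (rule image_subsetI)
      fix p assume "p \<in> fbot (Uc_obj P)"
      then have p: "p \<in> positions (elts (Uc_obj P))" "qle P (pos_value P p) (qbot P)"
        by (simp_all add: fbot_Uc_obj)
      have v: "pos_value P p \<in> carrier P"
        using p(1) closed[of "{p}"] by simp
      then have "qle Q (f (pos_value P p)) (f (qbot P))"
        using p by (intro gq_hom_mono[OF P.comm_quantale_axioms Q.comm_quantale_axioms f]) auto
      then have "qle Q (f (pos_value P p)) (qbot Q)"
        using gq_homD(2,6)[OF f] v by (auto intro: Q.qle_trans)
      then show "map_pos (Uc_map P Q f) p \<in> fbot (Uc_obj Q)"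
        unfolding fbot_Uc_obj using pos[OF p(1)] val[OF p(1)] by simp
    qed
  next
    fix A B
    assume A: "A \<subseteq> positions (elts (Uc_obj P))" and B: "B \<subseteq> positions (elts (Uc_obj P))"
      and "perp (Uc_obj P) A \<subseteq> perp (Uc_obj P) B"
    then have "qle P (qjoin P (pos_value P ` B)) (qjoin P (pos_value P ` A))"
      by (simp add: P.perp_Uc_subset_iff)
    then have "qle Q (f (qjoin P (pos_value P ` B))) (f (qjoin P (pos_value P ` A)))"
      using closed[OF A] closed[OF B]
      by (intro gq_hom_mono[OF P.comm_quantale_axioms Q.comm_quantale_axioms f]) auto
    moreover have "map_pos (Uc_map P Q f) ` A \<subseteq> positions (elts (Uc_obj Q))"
      "map_pos (Uc_map P Q f) ` B \<subseteq> positions (elts (Uc_obj Q))"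
      using A B pos by blast+
    ultimately show "perp (Uc_obj Q) (map_pos (Uc_map P Q f) ` A)
        \<subseteq> perp (Uc_obj Q) (map_pos (Uc_map P Q f) ` B)"
      by (simp add: Q.perp_Uc_subset_iff join[OF A] join[OF B])
  qed
qed

lemma Uc_map_id: "Uc_map Q Q (\<lambda>a\<in>carrier Q. a) = (\<lambda>x\<in>elts (Uc_obj Q). x)"
proof (intro ext)
  fix x
  show "Uc_map Q Q (\<lambda>a\<in>carrier Q. a) x = (\<lambda>x\<in>elts (Uc_obj Q). x) x"
  proof (cases "x \<in> elts (Uc_obj Q)")
    case True
    then have "x \<in> carrier Q \<times> carrier Q"
      using elts_Uc_carrier by blast
    with True show ?thesis
      by (auto simp: Uc_map_apply)
  qed (simp add: Uc_map_def)
qed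

lemma Uc_map_compose:
  assumes "girard_quantale P" "girard_quantale Q" and f: "f \<in> gq_hom P Q"
  shows "Uc_map P R (compose (carrier P) g f) =
    compose (elts (Uc_obj P)) (Uc_map Q R g) (Uc_map P Q f)"
proof (intro ext)
  fix x
  show "Uc_map P R (compose (carrier P) g f) x =
      compose (elts (Uc_obj P)) (Uc_map Q R g) (Uc_map P Q f) x"
  proof (cases "x \<in> elts (Uc_obj P)")
    case True
    then have "x \<in> carrier P \<times> carrier P"
      using elts_Uc_carrier by blast
    with True Uc_map_elts[OF assms True] show ?thesis
      by (auto simp: Uc_map_apply compose_def)
  qed (simp add: Uc_map_def compose_def)
qed

section \<open>The adjunction\<close>

lemma adj_unit_elts:
  assumes X: "X \<in> IFc" and x: "x \<in> elts X"
  shows "adj_unit X x \<in> elts (Uc_obj (F_obj X))"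
proof -
  interpret F: join_idempotent_quantale "F_obj X"
    using X by (rule join_idempotent_F_obj)
  have "biperp X {p} \<otimes>\<^bsub>F_obj X\<^esub> biperp X {p} = biperp X {p}" if "p \<in> positions (elts X)" for p
    using that perp_double[OF X that] by (subst biperp_single_mult) auto
  moreover have "biperp X {({#x#}, {#})} \<otimes>\<^bsub>F_obj X\<^esub> biperp X {({#}, {#x#})} = qjoin (F_obj X) {}"
  proof -
    have "({#x#}, {#}) + ({#}, {#x#}) = ({#x#}, {#x#})"
      by (simp add: prod_eq_iff)
    \<comment> \<open>Containment makes the orthogonal full, so the closure is that of the empty
      set, which is the empty join.\<close>
    moreover have "perp X {({#x#}, {#x#})} = perp X {}"
      using X x by (auto simp: IFc_def containment_elt_def mem_perp)
    ultimately show ?thesis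
      using x by (subst biperp_single_mult) (simp_all add: qjoin_F_obj)
  qed
  ultimately show ?thesis
    using x by (simp add: adj_unit_def F.elts_Uc_obj del: F_obj_simps)
qed

text \<open>Both sides turn sums of positions into tensors, and on generators they agree by the
  choice of the unit.\<close>

lemma adj_unit_value:
  assumes X: "X \<in> IFc" and p: "p \<in> positions (elts X)"
  shows "pos_value (F_obj X) (map_pos (adj_unit X) p) = biperp X {p}"
proof -
  interpret F: comm_quantale "F_obj X"
    by (rule comm_quantale_F_obj)
  have unit: "adj_unit X ` elts X \<subseteq> carrier (F_obj X) \<times> carrier (F_obj X)"
    using adj_unit_elts[OF X] elts_Uc_carrier by blast
  from p show ?thesis
  proof (induction rule: positions_induct)
    case zero
    then show ?case by simp
  next
    case (pos x p)
    have "pos_value (F_obj X) (map_pos (adj_unit X) (({#x#}, {#}) + p)) =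
        biperp X {({#x#}, {#})} \<otimes>\<^bsub>F_obj X\<^esub> biperp X {p}"
      using pos unit map_pos_positions[OF unit]
      by (simp add: F.pos_value_add image_subset_iff mem_Times_iff del: F_obj_simps)
         (simp add: adj_unit_def)
    then show ?case
      using pos by (simp add: biperp_single_mult del: F_obj_simps)
  next
    case (neg x p)
    have "pos_value (F_obj X) (map_pos (adj_unit X) (({#}, {#x#}) + p)) =
        biperp X {({#}, {#x#})} \<otimes>\<^bsub>F_obj X\<^esub> biperp X {p}"
      using neg unit map_pos_positions[OF unit]
      by (simp add: F.pos_value_add image_subset_iff mem_Times_iff del: F_obj_simps)
         (simp add: adj_unit_def)
    then show ?case
      using neg by (simp add: biperp_single_mult del: F_obj_simps)
  qed
qed

text \<open>The join of the values of the image of A is the closure of A, so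
  \<open>perp_Uc_subset_iff\<close> reduces the condition on orthogonals to antitonicity of
  \<open>perp\<close>.\<close>

lemma adj_unit_hom:
  assumes X: "X \<in> IFc"
  shows "adj_unit X \<in> if_hom X (Uc_obj (F_obj X))"
proof -
  interpret F: join_idempotent_quantale "F_obj X"
    using X by (rule join_idempotent_F_obj)
  have X': "frame X" using X by (simp add: IFc_def)
  have pos: "map_pos (adj_unit X) ` A \<subseteq> positions (elts (Uc_obj (F_obj X)))"
    if "A \<subseteq> positions (elts X)" for A
    using that adj_unit_elts[OF X] by (blast intro: map_pos_positions[of "adj_unit X" "elts X"])
  have join: "qjoin (F_obj X) (pos_value (F_obj X) ` map_pos (adj_unit X) ` A) = biperp X A"
    if "A \<subseteq> positions (elts X)" for A
  proof -
    have "pos_value (F_obj X) ` map_pos (adj_unit X) ` A = (\<lambda>p. biperp X {p}) ` A"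
      unfolding image_image using that by (intro image_cong) (auto simp: adj_unit_value[OF X])
    then have "qjoin (F_obj X) (pos_value (F_obj X) ` map_pos (adj_unit X) ` A) =
        biperp X (\<Union>p\<in>A. biperp X {p})"
      by (simp add: qjoin_F_obj image_subset_iff)
    also have "\<dots> = biperp X (\<Union>p\<in>A. {p})"
      using that by (intro biperp_Union) blast
    finally show ?thesis by simp
  qed
  show ?thesis
    unfolding if_hom_def mem_Collect_eq
  proof (intro conjI allI impI)
    show "adj_unit X \<in> elts X \<rightarrow>\<^sub>E elts (Uc_obj (F_obj X))"
      using adj_unit_elts[OF X] by (auto simp: adj_unit_def)
    show "map_pos (adj_unit X) ` fbot X \<subseteq> fbot (Uc_obj (F_obj X))"
    proof (rule image_subsetI)
      fix p assume p: "p \<in> fbot X"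
      then have p': "p \<in> positions (elts X)"
        using X' by (auto simp: frame_def)
      have "biperp X {p} \<subseteq> biperp X (fbot X)"
        using p by (intro biperp_mono) simp
      then have "biperp X {p} \<subseteq> fbot X"
        by (simp add: fbot_eq_perp[OF X'])
      then show "map_pos (adj_unit X) p \<in> fbot (Uc_obj (F_obj X))"
        using p' pos[of "{p}"] by (simp add: fbot_Uc_obj adj_unit_value[OF X])
    qed
  next
    fix A B
    assume "A \<subseteq> positions (elts X)" "B \<subseteq> positions (elts X)" "perp X A \<subseteq> perp X B"
    then show "perp (Uc_obj (F_obj X)) (map_pos (adj_unit X) ` A)
        \<subseteq> perp (Uc_obj (F_obj X)) (map_pos (adj_unit X) ` B)"
      by (simp add: F.perp_Uc_subset_iff pos join perp_antimono)
  qed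
qed

section \<open>Bijectivity of transposition\<close>

lemma adj_transpose_apply:
  assumes "X \<in> IFc" "x \<in> elts X"
  shows "adj_transpose X Q g x = (g (biperp X {({#x#}, {#})}), g (biperp X {({#}, {#x#})}))"
  using assms adj_unit_elts[OF assms]
  by (simp add: adj_transpose_def compose_def Uc_map_apply) (simp add: adj_unit_def)

lemma adj_transpose_hom:
  assumes X: "X \<in> IFc" and Q: "join_idempotent_quantale Q" and g: "g \<in> gq_hom (F_obj X) Q"
  shows "adj_transpose X Q g \<in> if_hom X (Uc_obj Q)"
proof -
  have "frame X"
    using X by (simp add: IFc_def)
  then show ?thesis
    unfolding adj_transpose_def
    by (rule if_hom_compose[OF adj_unit_hom[OF X] Uc_map_hom[OF join_idempotent_F_obj[OF X] Q g]])
qed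

text \<open>Taking values commutes with g, and the unit has the generated closed sets as values; the
  transpose therefore remembers g on these.\<close>

lemma adj_transpose_value:
  assumes X: "X \<in> IFc" and Q: "join_idempotent_quantale Q" and g: "g \<in> gq_hom (F_obj X) Q"
    and p: "p \<in> positions (elts X)"
  shows "pos_value Q (map_pos (adj_transpose X Q g) p) = g (biperp X {p})"
proof -
  interpret Q: join_idempotent_quantale Q by fact
  have "map_pos (adj_unit X) p \<in> positions (elts (Uc_obj (F_obj X)))"
    using p adj_unit_elts[OF X] by (intro map_pos_positions) auto
  moreover have "map_pos (adj_transpose X Q g) p = map_pos (Uc_map (F_obj X) Q g) (map_pos (adj_unit X) p)"
    unfolding map_pos_comp adj_transpose_def
    using p by (intro map_pos_cong[of "elts X"]) (auto simp: compose_def)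
  ultimately show ?thesis
    using pos_value_Uc_map[OF comm_quantale_F_obj Q.comm_quantale_axioms g]
    by (simp add: adj_unit_value[OF X p])
qed

text \<open>The closed sets generated by positions are join-dense and g preserves joins. The formula
  gives injectivity and dictates the preimage in \<open>adj_transpose_surj\<close>.\<close>

lemma adj_transpose_determines:
  assumes X: "X \<in> IFc" and Q: "join_idempotent_quantale Q" and g: "g \<in> gq_hom (F_obj X) Q"
    and A: "A \<in> carrier (F_obj X)"
  shows "g A = qjoin Q (pos_value Q ` map_pos (adj_transpose X Q g) ` A)"
proof -
  have "g A = g (qjoin (F_obj X) ((\<lambda>p. biperp X {p}) ` A))"
    using closed_eq_qjoin[OF A] by simp
  also have "\<dots> = qjoin Q (g ` (\<lambda>p. biperp X {p}) ` A)"
    by (rule gq_homD(3)[OF g]) auto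
  also have "g ` (\<lambda>p. biperp X {p}) ` A = pos_value Q ` map_pos (adj_transpose X Q g) ` A"
    unfolding image_image using carrier_F_objD(1)[OF A]
    by (intro image_cong) (auto simp: adj_transpose_value[OF X Q g])
  finally show ?thesis .
qed

lemma adj_transpose_inj:
  assumes "X \<in> IFc" "join_idempotent_quantale Q"
  shows "inj_on (adj_transpose X Q) (gq_hom (F_obj X) Q)"
proof (rule inj_onI)
  fix g h
  assume g: "g \<in> gq_hom (F_obj X) Q" and h: "h \<in> gq_hom (F_obj X) Q"
    and "adj_transpose X Q g = adj_transpose X Q h"
  then have "g A = h A" if "A \<in> carrier (F_obj X)" for A
    using that adj_transpose_determines[OF assms g] adj_transpose_determines[OF assms h] by simp
  then show "g = h"
    using gq_homD(1)[OF g] gq_homD(1)[OF h] by (rule PiE_ext[rotated 2])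
qed

lemma (in join_idempotent_quantale) adj_transpose_surj:
  assumes X: "X \<in> IFc" and h: "h \<in> if_hom X (Uc_obj Q)"
  shows "h \<in> adj_transpose X Q ` gq_hom (F_obj X) Q"
proof -
  have X': "frame X" using X by (simp add: IFc_def)
  \<comment> \<open>The candidate g is the right side of \<open>adj_transpose_determines\<close>
    with h in place of the transpose: v evaluates positions, and w extends v to sets by
    joins.\<close>
  define v where "v p = pos_value Q (map_pos h p)" for p
  define w where "w A = qjoin Q (v ` A)" for A
  define g where "g = (\<lambda>A\<in>carrier (F_obj X). w A)"
  note elts = if_hom_image[OF h]
  have h_pos: "map_pos h p \<in> positions (carrier Q \<times> carrier Q)" if "p \<in> positions (elts X)" for p
    using that elts elts_Uc_carrier by (intro map_pos_positions) auto
  have v_closed: "v p \<in> carrier Q" if "p \<in> positions (elts X)" for p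
    unfolding v_def using that by (intro pos_value_closed h_pos)
  have v_image: "v ` A \<subseteq> carrier Q" if "A \<subseteq> positions (elts X)" for A
    using that v_closed by blast
  have w_closed: "w A \<in> carrier Q" if "A \<subseteq> positions (elts X)" for A
    unfolding w_def using that by (intro qjoin_closed v_image)
  have perp_subset: "perp (Uc_obj Q) (map_pos h ` A) \<subseteq> perp (Uc_obj Q) (map_pos h ` B) \<longleftrightarrow> w B \<preceq> w A"
    if "A \<subseteq> positions (elts X)" "B \<subseteq> positions (elts X)" for A B
    unfolding w_def v_def
    using that perp_Uc_subset_iff[OF map_pos_image_positions[OF h] map_pos_image_positions[OF h]]
    by (simp add: image_image)
  \<comment> \<open>Here the condition of h on orthogonals enters: A and its closure have images
    with equal orthogonals, so their joins of values agree. Since joins and tensors in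
    \<open>F_obj X\<close> are closures, g can be computed on the unclosed sets.\<close>
  have w_biperp: "w (biperp X A) = w A" if A: "A \<subseteq> positions (elts X)" for A
    using perp_subset[OF A, of "biperp X A"] perp_subset[OF _ A, of "biperp X A"]
      perp_map_biperp[OF h A] A
    by (intro qle_antisym) (simp_all add: w_closed)
  have g_biperp: "g (biperp X A) = w A" if "A \<subseteq> positions (elts X)" for A
    using that by (simp add: g_def w_biperp)
  have v_add: "v (p + q) = v p \<otimes> v q" if "p \<in> positions (elts X)" "q \<in> positions (elts X)" for p q
    using that by (simp add: v_def pos_value_add h_pos)
  have "g \<in> gq_hom (F_obj X) Q"
    unfolding gq_hom_def mem_Collect_eq
  proof (intro conjI allI impI ballI)
    show "g \<in> carrier (F_obj X) \<rightarrow>\<^sub>E carrier Q"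
      using w_closed carrier_F_objD(1) by (auto simp: g_def)
  next
    fix \<A> assume \<A>: "\<A> \<subseteq> carrier (F_obj X)"
    then have A: "A \<subseteq> positions (elts X)" if "A \<in> \<A>" for A
      using that carrier_F_objD(1) by blast
    have "g (qjoin (F_obj X) \<A>) = w (\<Union>\<A>)"
      by (simp add: qjoin_F_obj[OF \<A>] g_biperp Union_carrier_F_obj[OF \<A>])
    also have "\<dots> = qjoin Q (\<Union>A\<in>\<A>. v ` A)"
      by (simp add: w_def image_Union)
    also have "\<dots> = qjoin Q (w ` \<A>)"
      unfolding w_def by (intro qjoin_UN v_image A)
    also have "w ` \<A> = g ` \<A>"
      using \<A> by (intro image_cong) (auto simp: g_def)
    finally show "g (qjoin (F_obj X) \<A>) = qjoin Q (g ` \<A>)" .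
  next
    fix A B assume AB: "A \<in> carrier (F_obj X)" "B \<in> carrier (F_obj X)"
    note pos = carrier_F_objD(1)[OF AB(1)] carrier_F_objD(1)[OF AB(2)]
    have "g (A \<otimes>\<^bsub>F_obj X\<^esub> B) = w (sumset A B)"
      using sumset_positions[OF pos] by (simp only: F_obj_simps g_biperp)
    \<comment> \<open>Additivity of v turns sums into tensors, so that \<open>qjoin_mult\<close> can
      factor the join.\<close>
    also have "v ` sumset A B = {a \<otimes> b | a b. a \<in> v ` A \<and> b \<in> v ` B}"
    proof (intro equalityI subsetI)
      fix c assume "c \<in> v ` sumset A B"
      then obtain a b where "a \<in> A" "b \<in> B" "c = v (a + b)" by blast
      then show "c \<in> {a \<otimes> b | a b. a \<in> v ` A \<and> b \<in> v ` B}"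
        using pos v_add[of a b] by blast
    next
      fix c assume "c \<in> {a \<otimes> b | a b. a \<in> v ` A \<and> b \<in> v ` B}"
      then obtain a b where ab: "a \<in> A" "b \<in> B" and c: "c = v a \<otimes> v b" by blast
      then have "c = v (a + b)"
        using pos v_add by (simp add: subset_iff)
      then show "c \<in> v ` sumset A B"
        using ab by blast
    qed
    then have "w (sumset A B) = w A \<otimes> w B"
      unfolding w_def using pos by (simp only: qjoin_mult v_image)
    finally show "g (A \<otimes>\<^bsub>F_obj X\<^esub> B) = g A \<otimes> g B"
      using AB by (simp add: g_def)
  next
    show "g \<one>\<^bsub>F_obj X\<^esub> = \<one>"
      by (simp add: g_biperp w_def v_def)
  next
    have pos: "fbot X \<subseteq> positions (elts X)"
      using X' by (simp add: frame_def)
    have "v p \<preceq> qbot Q" if "p \<in> fbot X" for p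
      using if_homD(2)[OF h] that by (auto simp: v_def fbot_Uc_obj)
    then have "w (fbot X) \<preceq> qbot Q"
      unfolding w_def using v_image[OF pos] by (auto simp: qjoin_le_iff)
    moreover have "fbot X \<in> carrier (F_obj X)"
      by (simp add: fbot_eq_perp[OF X'])
    ultimately show "g (qbot (F_obj X)) \<preceq> qbot Q"
      by (simp add: g_def)
  qed
  moreover have "h = adj_transpose X Q g"
  proof
    fix x
    show "h x = adj_transpose X Q g x"
    proof (cases "x \<in> elts X")
      case True
      then have "h x \<in> carrier Q \<times> carrier Q"
        using elts elts_Uc_carrier by blast
      with True show ?thesis
        by (simp add: adj_transpose_apply[OF X] g_biperp w_def v_def prod_eq_iff mem_Times_iff)
    next
      case False
      then show ?thesis
        \<comment> \<open>Off \<open>elts X\<close> both sides are \<open>undefined\<close>: h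
          because it is extensional, the transpose because it is a \<open>compose\<close> over
          \<open>elts X\<close>.\<close>
        using PiE_arb[OF if_homD(1)[OF h] False] by (simp add: adj_transpose_def compose_def)
    qed
  qed
  ultimately show ?thesis
    by blast
qed

lemma adj_transpose_bij:
  assumes X: "X \<in> IFc" and Q: "join_idempotent_quantale Q"
  shows "bij_betw (adj_transpose X Q) (gq_hom (F_obj X) Q) (if_hom X (Uc_obj Q))"
  unfolding bij_betw_def
proof (intro conjI equalityI image_subsetI subsetI)
  show "inj_on (adj_transpose X Q) (gq_hom (F_obj X) Q)"
    using X Q by (rule adj_transpose_inj)
  show "adj_transpose X Q g \<in> if_hom X (Uc_obj Q)" if "g \<in> gq_hom (F_obj X) Q" for g
    using X Q that by (rule adj_transpose_hom)
  show "h \<in> adj_transpose X Q ` gq_hom (F_obj X) Q" if "h \<in> if_hom X (Uc_obj Q)" for h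
    using Q X that by (rule join_idempotent_quantale.adj_transpose_surj)
qed

section \<open>Naturality of transposition in both arguments\<close>

lemma adj_transpose_natural_left:
  assumes X: "X \<in> IFc" and Y: "Y \<in> IFc" and h: "h \<in> if_hom X Y"
  shows "adj_transpose X Q (compose (carrier (F_obj X)) g (F_map X Y h)) =
    compose (elts X) (adj_transpose Y Q g) h"
proof
  fix x
  show "adj_transpose X Q (compose (carrier (F_obj X)) g (F_map X Y h)) x =
      compose (elts X) (adj_transpose Y Q g) h x"
  proof (cases "x \<in> elts X")
    case True
    moreover have "h x \<in> elts Y"
      using True if_hom_image[OF h] by blast
    \<comment> \<open>\<open>F_map X Y h\<close> sends the closed sets generated by x on either side
      to those generated by \<open>h x\<close>, so both functions apply g to the same pair.\<close>
    ultimately show ?thesis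
      by (simp add: adj_transpose_apply X Y compose_eq F_map_biperp[OF h])
  qed (simp add: adj_transpose_def compose_def)
qed

lemma adj_transpose_natural_right:
  assumes X: "X \<in> IFc" and P: "join_idempotent_quantale P" and g: "g \<in> gq_hom (F_obj X) P"
  shows "adj_transpose X Q (compose (carrier (F_obj X)) k g) =
    compose (elts X) (Uc_map P Q k) (adj_transpose X P g)"
proof
  fix x
  show "adj_transpose X Q (compose (carrier (F_obj X)) k g) x =
      compose (elts X) (Uc_map P Q k) (adj_transpose X P g) x"
  proof (cases "x \<in> elts X")
    case True
    then have "adj_transpose X P g x \<in> elts (Uc_obj P)"
      using if_hom_image[OF adj_transpose_hom[OF X P g]] by blast
    with True show ?thesis
      \<comment> \<open>The transpose stays folded in the first call, so that its membership in
        \<open>elts (Uc_obj P)\<close> justifies \<open>Uc_map_apply\<close>; only then are its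
        components computed.\<close>
      by (simp add: compose_eq Uc_map_apply) (simp add: adj_transpose_apply X compose_eq)
  qed (simp add: adj_transpose_def compose_def)
qed

theorem lemma4p1:
  shows
    "(\<forall>Q\<in>(GQji :: 'a quantale set). Uc_obj Q \<in> IFc) \<and>
     (\<forall>P\<in>(GQji :: 'a quantale set). \<forall>Q\<in>(GQji :: 'b quantale set).
        \<forall>f\<in>gq_hom P Q. Uc_map P Q f \<in> if_hom (Uc_obj P) (Uc_obj Q)) \<and>
     (\<forall>Q\<in>(GQji :: 'a quantale set).
        Uc_map Q Q (\<lambda>a\<in>carrier Q. a) = (\<lambda>x\<in>elts (Uc_obj Q). x)) \<and>
     (\<forall>P\<in>(GQji :: 'a quantale set). \<forall>Q\<in>(GQji :: 'b quantale set).
        \<forall>R\<in>(GQji :: 'c quantale set). \<forall>f\<in>gq_hom P Q. \<forall>g\<in>gq_hom Q R.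
        Uc_map P R (compose (carrier P) g f) =
          compose (elts (Uc_obj P)) (Uc_map Q R g) (Uc_map P Q f)) \<and>

     (\<forall>X\<in>(IFc :: 'x frame set). Fc_obj X \<in> GQji) \<and>
     (\<forall>X\<in>(IFc :: 'x frame set). \<forall>Y\<in>(IFc :: 'y frame set).
        \<forall>f\<in>if_hom X Y. Fc_map X Y f \<in> gq_hom (Fc_obj X) (Fc_obj Y)) \<and>
     (\<forall>X\<in>(IFc :: 'x frame set).
        Fc_map X X (\<lambda>x\<in>elts X. x) = (\<lambda>A\<in>carrier (Fc_obj X). A)) \<and>
     (\<forall>X\<in>(IFc :: 'x frame set). \<forall>Y\<in>(IFc :: 'y frame set).
        \<forall>Z\<in>(IFc :: 'z frame set). \<forall>f\<in>if_hom X Y. \<forall>g\<in>if_hom Y Z.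
        Fc_map X Z (compose (elts X) g f) =
          compose (carrier (Fc_obj X)) (Fc_map Y Z g) (Fc_map X Y f)) \<and>

     (\<forall>X\<in>(IFc :: 'x frame set). \<forall>Q\<in>(GQji :: 'a quantale set).
        bij_betw (adj_transpose X Q) (gq_hom (Fc_obj X) Q) (if_hom X (Uc_obj Q))) \<and>
     (\<forall>X\<in>(IFc :: 'x frame set). \<forall>Y\<in>(IFc :: 'y frame set).
        \<forall>Q\<in>(GQji :: 'a quantale set). \<forall>h\<in>if_hom X Y. \<forall>g\<in>gq_hom (Fc_obj Y) Q.
        adj_transpose X Q (compose (carrier (Fc_obj X)) g (Fc_map X Y h)) =
          compose (elts X) (adj_transpose Y Q g) h) \<and>
     (\<forall>X\<in>(IFc :: 'x frame set). \<forall>P\<in>(GQji :: 'a quantale set).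
        \<forall>Q\<in>(GQji :: 'b quantale set). \<forall>g\<in>gq_hom (Fc_obj X) P. \<forall>k\<in>gq_hom P Q.
        adj_transpose X Q (compose (carrier (Fc_obj X)) k g) =
          compose (elts X) (Uc_map P Q k) (adj_transpose X P g))"
proof -
  \<comment> \<open>Both auxiliary facts are generic in the element type \<open>'i\<close>, since
    the conjuncts involve frames and quantales over several types.\<close>
  have frame: "frame X" if "X \<in> IFc" for X :: "'i frame"
    using that by (simp add: IFc_def)
  have ji: "join_idempotent_quantale Q" "girard_quantale Q" if "Q \<in> GQji" for Q :: "'i quantale"
    using that by (auto simp: GQji_iff join_idempotent_quantale_def)
  show ?thesis
    by (intro conjI ballI Uc_obj_IFc Uc_map_hom Uc_map_id Uc_map_compose
        join_idempotent_F_obj[folded GQji_iff] F_map_hom F_map_id F_map_compose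
        adj_transpose_bij adj_transpose_natural_left adj_transpose_natural_right)
      (assumption | erule frame ji)+
qed

end
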